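(* Let $k$ be a field of characteristic $0$, $S=k[x_1,\dots,x_n]$, $\ell=x_1+\cdots+x_n\in S$, and let $h_e$ be the complete symmetric polynomial of degree $e$ in $X_1,\dots,X_n$. For even socle degree, $e=2d$, we have $\operatorname{ann}(h_{2d})=(M_{d+1}\oplus \ell M_d)$, i.e. the sum of the subspaces $M_{d+1}$ and $\ell M_d$ of $S_{d+1}$ is direct and $\operatorname{ann}(h_{2d})$ is the ideal of $S$ generated by it. For odd socle degree, $e=2d+1$, we have $\operatorname{ann}(h_{2d+1})=(M_{d+1}+\ell^2M_d)$, i.e. $\operatorname{ann}(h_{2d+1})$ is the ideal of $S$ generated by $M_{d+1}$ and $\ell^2M_d$.
   Context: $E=k[X_1,\dots,X_n]$ is an $S$-module where $x_i$ acts as $\partial/\partial X_i$ (action written $\circ$), and $\operatorname{ann}(f)=\{g\in S:g\circ f=0\}$. $h_e=\sum_{i_1+\cdots+i_n=e}X_1^{i_1}\cdots X_n^{i_n}$. Let $\Phi:S\to E$ be the $k$-linear map with $\Phi(x_1^{i_1}\cdots x_n^{i_n})=i_1!\cdots i_n!\,X_1^{i_1}\cdots X_n^{i_n}$. Let $E'=k[X_1-X_n,X_2-X_n,\dots,X_{n-1}-X_n]\subseteq E$, with degree-$d$ part $E'_d$, and define $M_d=\Phi^{-1}(E'_d)\subseteq S_d$ for integers $d\ge 0$. Also $\ell^iM_d=\{\ell^i f: f\in M_d\}$.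
   Formalization: The number of variables is assumed to be n ≥ 2: for n = 1 and d ≥ 1 one has E' = k, so M_d = M_{d+1} = 0, while ann(h_e) = (x_1^{e+1}) is nonzero, so the claim fails there. *)

theory Defs
  imports Complex_Main "HOL-Library.FuncSet" "HOL-Library.Cardinality" "HOL-Library.Poly_Mapping" "HOL-Library.Set_Algebras"
begin

text \<open>
  The index type \<open>'n\<close> is finite and linearly ordered, so its elements are the indices
  \<open>1 < \<dots> < n\<close> with \<open>n = CARD('n)\<close>. An exponent vector is an element of \<open>'n \<Rightarrow>\<^sub>0 nat\<close>.
  The polynomial ring \<open>S\<close> (variables \<open>x\<^sub>i\<close>) and the module \<open>E\<close> (variables \<open>X\<^sub>i\<close>) share
  the following type.
\<close>

type_synonym ('n, 'k) mpoly = "('n \<Rightarrow>\<^sub>0 nat) \<Rightarrow>\<^sub>0 'k"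

definition const :: "'k::field_char_0 \<Rightarrow> ('n, 'k) mpoly"
  where "const c = Poly_Mapping.single 0 c"

definition var :: "'n \<Rightarrow> ('n, 'k::field_char_0) mpoly"
  where "var i = Poly_Mapping.single (Poly_Mapping.single i 1) 1"

definition mdeg :: "('n::finite \<Rightarrow>\<^sub>0 nat) \<Rightarrow> nat"
  where "mdeg a = (\<Sum>i\<in>UNIV. Poly_Mapping.lookup a i)"

definition homog :: "nat \<Rightarrow> ('n::finite, 'k::field_char_0) mpoly set"
  where "homog d = {f. \<forall>a\<in>Poly_Mapping.keys f. mdeg a = d}"

subsection \<open>The action of \<open>S\<close> on \<open>E\<close> by differentiation\<close>

definition partial_deriv ::
    "'n \<Rightarrow> ('n, 'k::field_char_0) mpoly \<Rightarrow> ('n, 'k) mpoly"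
  where "partial_deriv i f =
    (\<Sum>b\<in>Poly_Mapping.keys f. Poly_Mapping.single (b - Poly_Mapping.single i 1)
      (of_nat (Poly_Mapping.lookup b i) * Poly_Mapping.lookup f b))"

definition monom_deriv ::
    "('n::{finite,linorder} \<Rightarrow>\<^sub>0 nat) \<Rightarrow> ('n, 'k::field_char_0) mpoly \<Rightarrow> ('n, 'k) mpoly"
  where "monom_deriv a f =
    foldr (\<lambda>i. partial_deriv i ^^ Poly_Mapping.lookup a i) (sorted_list_of_set UNIV) f"

definition act ::
    "('n::{finite,linorder}, 'k::field_char_0) mpoly \<Rightarrow> ('n, 'k) mpoly \<Rightarrow> ('n, 'k) mpoly"
    (infixr \<open>\<circle>\<close> 70)
  where "g \<circle> f = (\<Sum>a\<in>Poly_Mapping.keys g. const (Poly_Mapping.lookup g a) * monom_deriv a f)"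

definition ann ::
    "('n::{finite,linorder}, 'k::field_char_0) mpoly \<Rightarrow> ('n, 'k) mpoly set"
  where "ann f = {g. g \<circle> f = 0}"

subsection \<open>Complete symmetric polynomials, the map \<open>\<Phi>\<close> and the spaces \<open>M\<^sub>d\<close>\<close>

definition hsym :: "nat \<Rightarrow> ('n::finite, 'k::field_char_0) mpoly"
  where "hsym e = (\<Sum>a | mdeg a = e. Poly_Mapping.single a 1)"

definition ell :: "('n::finite, 'k::field_char_0) mpoly"
  where "ell = (\<Sum>i\<in>UNIV. var i)"

definition Phi :: "('n::finite, 'k::field_char_0) mpoly \<Rightarrow> ('n, 'k) mpoly"
  where "Phi f = Poly_Mapping.mapp (\<lambda>a c. (\<Prod>i\<in>UNIV. fact (Poly_Mapping.lookup a i)) * c) f"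

inductive_set subalgebra ::
    "('n, 'k::field_char_0) mpoly set \<Rightarrow> ('n, 'k) mpoly set"
  for G :: "('n, 'k) mpoly set"
  where
    const: "const c \<in> subalgebra G"
  | gen: "g \<in> G \<Longrightarrow> g \<in> subalgebra G"
  | add: "f \<in> subalgebra G \<Longrightarrow> g \<in> subalgebra G \<Longrightarrow> f + g \<in> subalgebra G"
  | mult: "f \<in> subalgebra G \<Longrightarrow> g \<in> subalgebra G \<Longrightarrow> f * g \<in> subalgebra G"

definition last_index :: "'n::{finite,linorder}"
  where "last_index = Max UNIV"

definition E' :: "('n::{finite,linorder}, 'k::field_char_0) mpoly set"
  where "E' = subalgebra {var i - var last_index | i. i \<noteq> last_index}"

definition M :: "nat \<Rightarrow> ('n::{finite,linorder}, 'k::field_char_0) mpoly set"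
  where "M d = Phi -` (E' \<inter> homog d)"

text \<open>The ideal generated by a set: its span in the ring regarded as a module over itself.\<close>

definition ideal_of :: "'a::comm_ring_1 set \<Rightarrow> 'a set"
  where "ideal_of A = module.span (*) A"

subsection \<open>Basic facts\<close>

lemma module_times: "module ((*) :: 'a::comm_ring_1 \<Rightarrow> 'a \<Rightarrow> 'a)"
  by unfold_locales (auto simp: algebra_simps)

lemma lookup_const_mult: "Poly_Mapping.lookup (const c * f) a = c * Poly_Mapping.lookup f a"
  unfolding const_def mult_map_scale_conv_mult[symmetric]
  by transfer (auto simp: when_def)

lemma finite_mdeg_eq: "finite {a :: 'n::finite \<Rightarrow>\<^sub>0 nat. mdeg a = e}"
proof -
  have "Poly_Mapping.lookup ` {a :: 'n \<Rightarrow>\<^sub>0 nat. mdeg a = e} \<subseteq> Pi\<^sub>E UNIV (\<lambda>_. {..e})"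
    by (auto simp: mdeg_def PiE_def intro: member_le_sum)
  then have "finite (Poly_Mapping.lookup ` {a :: 'n \<Rightarrow>\<^sub>0 nat. mdeg a = e})"
    by (rule finite_subset) (simp add: finite_PiE)
  then show ?thesis
    by (rule finite_imageD) (simp add: inj_on_def lookup_inject)
qed

lemma lookup_hsym: "Poly_Mapping.lookup (hsym e) a = (if mdeg a = e then 1 else 0)"
  by (simp add: hsym_def lookup_sum lookup_single when_def finite_mdeg_eq)

lemma lookup_partial_deriv:
  "Poly_Mapping.lookup (partial_deriv i f) c =
    of_nat (Suc (Poly_Mapping.lookup c i)) * Poly_Mapping.lookup f (c + Poly_Mapping.single i 1)"
proof -
  have eq: "Poly_Mapping.lookup (Poly_Mapping.single (b - Poly_Mapping.single i 1)
        (of_nat (Poly_Mapping.lookup b i) * Poly_Mapping.lookup f b)) c =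
      (if b = c + Poly_Mapping.single i 1
       then of_nat (Suc (Poly_Mapping.lookup c i)) * Poly_Mapping.lookup f (c + Poly_Mapping.single i 1) else 0)" for b
  proof (cases "Poly_Mapping.lookup b i = 0")
    case True
    then have "b \<noteq> c + Poly_Mapping.single i 1"
      by (auto simp: lookup_add)
    with True show ?thesis by simp
  next
    case False
    then have "b - Poly_Mapping.single i 1 = c \<longleftrightarrow> b = c + Poly_Mapping.single i 1"
      by (auto simp: poly_mapping_eq_iff fun_eq_iff lookup_add lookup_minus lookup_single when_def)
    then show ?thesis
      by (auto simp: lookup_single when_def lookup_add)
  qed
  show ?thesis
    unfolding partial_deriv_def lookup_sum eq
    by (auto simp: in_keys_iff)
qed

lemma partial_deriv_single:
  "partial_deriv i (Poly_Mapping.single b c) =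
    Poly_Mapping.single (b - Poly_Mapping.single i 1) (of_nat (Poly_Mapping.lookup b i) * c)"
  by (cases "c = 0") (auto simp: partial_deriv_def)

lemma lookup_partial_deriv_funpow:
  "Poly_Mapping.lookup ((partial_deriv i ^^ k) f) c =
    pochhammer (of_nat (Suc (Poly_Mapping.lookup c i))) k * Poly_Mapping.lookup f (c + Poly_Mapping.single i k)"
proof (induction k arbitrary: c)
  case 0
  then show ?case by simp
next
  case (Suc k)
  have "c + Poly_Mapping.single i 1 + Poly_Mapping.single i k = c + Poly_Mapping.single i (Suc k)"
    by (simp add: add.assoc single_add[symmetric])
  then show ?case
    using Suc.IH[of "c + Poly_Mapping.single i 1"]
    by (simp add: lookup_partial_deriv lookup_add pochhammer_rec algebra_simps)
qed

lemma lookup_monom_deriv: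
  fixes f :: "('n::{finite,linorder}, 'k::field_char_0) mpoly"
  shows "Poly_Mapping.lookup (monom_deriv a f) c =
    (\<Prod>i\<in>UNIV. pochhammer (of_nat (Suc (Poly_Mapping.lookup c i))) (Poly_Mapping.lookup a i)) * Poly_Mapping.lookup f (c + a)"
proof -
  have gen: "Poly_Mapping.lookup (foldr (\<lambda>i. partial_deriv i ^^ Poly_Mapping.lookup a i) xs f) c =
      (\<Prod>i\<in>set xs. pochhammer (of_nat (Suc (Poly_Mapping.lookup c i))) (Poly_Mapping.lookup a i)) *
      Poly_Mapping.lookup f (c + (\<Sum>i\<in>set xs. Poly_Mapping.single i (Poly_Mapping.lookup a i)))"
    if "distinct xs" for xs
    using that
  proof (induction xs arbitrary: c)
    case Nil
    then show ?case by simp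
  next
    case (Cons i xs)
    have "(\<Prod>j\<in>set xs. pochhammer
          (of_nat (Suc (Poly_Mapping.lookup (c + Poly_Mapping.single i (Poly_Mapping.lookup a i)) j)) :: 'k) (Poly_Mapping.lookup a j)) =
        (\<Prod>j\<in>set xs. pochhammer (of_nat (Suc (Poly_Mapping.lookup c j))) (Poly_Mapping.lookup a j))"
      using Cons.prems by (intro prod.cong) (auto simp: lookup_add lookup_single when_def)
    with Cons show ?case
      by (simp add: lookup_partial_deriv_funpow add.assoc mult.assoc)
  qed
  have "(\<Sum>i\<in>UNIV. Poly_Mapping.single i (Poly_Mapping.lookup a i)) = a"
    by (rule poly_mapping_eqI) (simp add: lookup_sum lookup_single when_def)
  then show ?thesis
    unfolding monom_deriv_def by (subst gen) simp_all
qed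

lemma monom_deriv_add: "monom_deriv (a + b) f = monom_deriv a (monom_deriv b f)"
proof (rule poly_mapping_eqI)
  fix c
  show "Poly_Mapping.lookup (monom_deriv (a + b) f) c = Poly_Mapping.lookup (monom_deriv a (monom_deriv b f)) c"
    by (simp add: lookup_monom_deriv lookup_add pochhammer_product' prod.distrib
        algebra_simps)
qed

lemma lookup_act:
  "Poly_Mapping.lookup (g \<circle> f) c = (\<Sum>a\<in>Poly_Mapping.keys g. Poly_Mapping.lookup g a * Poly_Mapping.lookup (monom_deriv a f) c)"
  by (simp add: act_def lookup_sum lookup_const_mult)

lemma act_var:
  fixes f :: "('n::{finite,linorder}, 'k::field_char_0) mpoly"
  shows "var i \<circle> f = partial_deriv i f"
proof (rule poly_mapping_eqI)
  fix c
  have "(\<Prod>j\<in>UNIV. pochhammer (of_nat (Suc (Poly_Mapping.lookup c j)) :: 'k)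
        (Poly_Mapping.lookup (Poly_Mapping.single i 1) j)) =
      (\<Prod>j\<in>UNIV. if j = i then of_nat (Suc (Poly_Mapping.lookup c i)) else 1)"
    by (intro prod.cong) (auto simp: lookup_single when_def)
  then show "Poly_Mapping.lookup (var i \<circle> f) c = Poly_Mapping.lookup (partial_deriv i f) c"
    by (simp add: lookup_act var_def lookup_monom_deriv lookup_partial_deriv)
qed

lemma act_one: "1 \<circle> f = f"
  by (rule poly_mapping_eqI) (simp add: lookup_act lookup_monom_deriv)

lemma act_add_left: "(g + h) \<circle> f = g \<circle> f + h \<circle> f"
proof (rule poly_mapping_eqI)
  fix c
  define A where "A = Poly_Mapping.keys g \<union> Poly_Mapping.keys h \<union> Poly_Mapping.keys (g + h)"
  have sup: "Poly_Mapping.lookup (p \<circle> f) c = (\<Sum>a\<in>A. Poly_Mapping.lookup p a * Poly_Mapping.lookup (monom_deriv a f) c)"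
    if "Poly_Mapping.keys p \<subseteq> A" for p
    unfolding lookup_act using that
    by (intro sum.mono_neutral_left) (auto simp: A_def in_keys_iff)
  show "Poly_Mapping.lookup ((g + h) \<circle> f) c = Poly_Mapping.lookup (g \<circle> f + h \<circle> f) c"
    unfolding lookup_add by (subst (1 2 3) sup)
      (auto simp: A_def lookup_add algebra_simps sum.distrib)
qed

lemma act_add_right: "g \<circle> (f + f') = g \<circle> f + g \<circle> f'"
  by (rule poly_mapping_eqI)
    (simp add: lookup_act lookup_add lookup_monom_deriv algebra_simps sum.distrib)

lemma act_sum_left: "(\<Sum>x\<in>A. g x) \<circle> f = (\<Sum>x\<in>A. g x \<circle> f)"
proof -
  have "0 \<circle> f = 0" by (simp add: act_def)
  then show ?thesis
    by (induction A rule: infinite_finite_induct) (simp_all add: act_add_left)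
qed

lemma act_sum_right: "g \<circle> (\<Sum>x\<in>A. f x) = (\<Sum>x\<in>A. g \<circle> f x)"
proof -
  have "g \<circle> 0 = 0" by (rule poly_mapping_eqI) (simp add: lookup_act lookup_monom_deriv)
  then show ?thesis
    by (induction A rule: infinite_finite_induct) (simp_all add: act_add_right)
qed

lemma act_single: "Poly_Mapping.single a c \<circle> f = const c * monom_deriv a f"
  by (cases "c = 0") (auto simp: act_def const_def)

lemma sum_single_lookup: "(\<Sum>a\<in>Poly_Mapping.keys f. Poly_Mapping.single a (Poly_Mapping.lookup f a)) = f"
  by (rule poly_mapping_eqI) (auto simp: lookup_sum lookup_single when_def in_keys_iff)

lemma act_mult: "(g * h) \<circle> f = g \<circle> (h \<circle> f)"
proof -
  have single: "(Poly_Mapping.single a c * Poly_Mapping.single b e) \<circle> f =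
      Poly_Mapping.single a c \<circle> (Poly_Mapping.single b e \<circle> f)" for a b c e
    by (rule poly_mapping_eqI)
      (simp add: mult_single act_single monom_deriv_add lookup_const_mult
        lookup_monom_deriv algebra_simps)
  define G where "G = (\<lambda>a. Poly_Mapping.single a (Poly_Mapping.lookup g a))"
  define H where "H = (\<lambda>a. Poly_Mapping.single a (Poly_Mapping.lookup h a))"
  have "(sum G (Poly_Mapping.keys g) * sum H (Poly_Mapping.keys h)) \<circle> f = sum G (Poly_Mapping.keys g) \<circle> (sum H (Poly_Mapping.keys h) \<circle> f)"
    unfolding sum_product act_sum_left act_sum_right G_def H_def single
    by (rule sum.swap)
  then show ?thesis
    by (simp add: G_def H_def sum_single_lookup)
qed

lemma lookup_Phi: "Poly_Mapping.lookup (Phi f) a = (\<Prod>i\<in>UNIV. fact (Poly_Mapping.lookup a i)) * Poly_Mapping.lookup f a"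
  by (auto simp: Phi_def lookup_mapp when_def in_keys_iff)

lemma Phi_single:
  "Phi (Poly_Mapping.single a 1) = const (\<Prod>i\<in>UNIV. fact (Poly_Mapping.lookup a i)) * Poly_Mapping.single a 1"
  by (rule poly_mapping_eqI) (auto simp: lookup_Phi lookup_const_mult lookup_single when_def)

lemma Phi_add: "Phi (f + g) = Phi f + Phi g"
  by (rule poly_mapping_eqI) (simp add: lookup_Phi lookup_add algebra_simps)

lemma Phi_const_mult: "Phi (const c * f) = const c * Phi f"
  by (rule poly_mapping_eqI) (simp add: lookup_Phi lookup_const_mult)

lemma M_subset_homog: "M d \<subseteq> homog d"
  by (auto simp: M_def homog_def in_keys_iff lookup_Phi)

lemma zero_in_M: "0 \<in> M d"
proof -
  have Phi_0: "Phi 0 = 0" by (rule poly_mapping_eqI) (simp add: lookup_Phi)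
  have "const 0 \<in> subalgebra {var i - var last_index | i. i \<noteq> last_index}"
    by (rule subalgebra.const)
  then show ?thesis
    by (simp add: M_def E'_def homog_def const_def Phi_0)
qed

lemma M_add: "f \<in> M d \<Longrightarrow> g \<in> M d \<Longrightarrow> f + g \<in> M d"
  using keys_add[of "Phi f" "Phi g"]
  by (auto simp: M_def E'_def homog_def Phi_add intro: subalgebra.add)

lemma M_const_mult: "f \<in> M d \<Longrightarrow> const c * f \<in> M d"
  by (auto simp: M_def E'_def homog_def Phi_const_mult in_keys_iff lookup_const_mult
      intro: subalgebra.mult subalgebra.const)

end

theory Submission
  imports Defs
begin

text \<open>
  Let \<open>moment\<close> be the linear form with \<open>x\<^sup>a \<mapsto> a!\<close>. A form \<open>g\<close> of degree \<open>m\<close> annihilates \<open>hsym e\<close> iff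
  \<open>moment (g u) = 0\<close> for all forms \<open>u\<close> of degree \<open>e - m\<close>. Conjugating \<open>\<partial>/\<partial>X\<^sub>1 + \<dots> + \<partial>/\<partial>X\<^sub>n\<close> by \<open>Phi\<close> gives an
  operator \<open>lowering\<close> with kernel \<open>M d\<close> in degree \<open>d\<close>, which forms an \<open>sl\<^sub>2\<close>-triple with multiplication by \<open>ell\<close>;
  hence every form of degree \<open>d\<close> lies in \<open>M d + ell S\<close>. Integration by parts shows that \<open>M d\<close> is
  orthogonal to all forms of smaller degree and that the pairing \<open>moment (f g)\<close> is nondegenerate
  in each degree. This determines the annihilator in the lowest degrees.

  In higher degrees let \<open>\<phi>\<close> be a linear form vanishing on the ideal of the known generators. By induction
  \<open>\<phi> (x\<^sub>i p) = moment (p u\<^sub>i)\<close> for some \<open>u\<^sub>i\<close>, and \<open>x\<^sub>j u\<^sub>i - x\<^sub>i u\<^sub>j\<close> is orthogonal to all forms of the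
  complementary degree. By nondegeneracy it vanishes, so \<open>u\<^sub>i = x\<^sub>i v\<close> and \<open>\<phi>\<close> is the pairing with \<open>v\<close>, which
  kills the annihilator. The one exception, degree \<open>d + 2\<close> for \<open>e = 2 d + 1\<close>, has
  \<open>x\<^sub>j u\<^sub>i - x\<^sub>i u\<^sub>j\<close> in \<open>M (d + 1)\<close>; there the generators in \<open>ell\<^sup>2 M d\<close> force \<open>u\<^sub>1 + \<dots> + u\<^sub>n = ell v\<close>.
\<close>

section \<open>Induction on polynomials and scalar arithmetic\<close>

lemma mpoly_induct [case_names zero single add]:
  fixes f :: "('n, 'k::field_char_0) mpoly"
  assumes "P 0" "\<And>a c. P (Poly_Mapping.single a c)" "\<And>f g. P f \<Longrightarrow> P g \<Longrightarrow> P (f + g)"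
  shows "P f"
proof -
  have "P (\<Sum>a\<in>A. Poly_Mapping.single a (Poly_Mapping.lookup f a))" for A
    by (induction A rule: infinite_finite_induct) (auto intro: assms)
  then show ?thesis by (metis sum_single_lookup)
qed

lemma const_0 [simp]: "const 0 = 0"
  and const_1 [simp]: "const 1 = 1"
  and const_add: "const (c + d) = const c + const d"
  and const_mult: "const (c * d) = const c * const d"
  and const_of_nat: "const (of_nat m) = of_nat m"
  by (simp_all add: const_def single_add mult_single)

lemma const_inverse_mult [simp]: "c \<noteq> 0 \<Longrightarrow> const (inverse c) * (const c * f) = f"
  by (simp add: mult.assoc[symmetric] const_mult[symmetric])

lemma const_mult_inverse [simp]: "c \<noteq> 0 \<Longrightarrow> const c * (const (inverse c) * f) = f"
  by (simp add: mult.assoc[symmetric] const_mult[symmetric])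

subsection \<open>Partial derivatives\<close>

lemma partial_deriv_0 [simp]: "partial_deriv i 0 = 0"
  by (simp add: partial_deriv_def)

lemma partial_deriv_add: "partial_deriv i (f + g) = partial_deriv i f + partial_deriv i g"
  by (rule poly_mapping_eqI) (simp only: lookup_partial_deriv lookup_add distrib_left)

lemma partial_deriv_diff: "partial_deriv i (f - g) = partial_deriv i f - partial_deriv i g"
  by (rule poly_mapping_eqI) (simp only: lookup_partial_deriv lookup_minus right_diff_distrib)

lemma partial_deriv_const_mult: "partial_deriv i (const c * f) = const c * partial_deriv i f"
  by (rule poly_mapping_eqI) (simp add: lookup_partial_deriv lookup_const_mult)

lemma partial_deriv_const [simp]: "partial_deriv i (const c) = 0"
  by (simp add: const_def partial_deriv_single)

lemma partial_deriv_var: "partial_deriv i (var j) = (if i = j then 1 else 0)"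
  by (auto simp: var_def partial_deriv_single lookup_single when_def)

lemma partial_deriv_mult_single:
  fixes c d :: "'k::field_char_0"
  shows "partial_deriv i (Poly_Mapping.single a c * Poly_Mapping.single b d) =
    partial_deriv i (Poly_Mapping.single a c) * Poly_Mapping.single b d +
    Poly_Mapping.single a c * partial_deriv i (Poly_Mapping.single b d)"
proof -
  let ?e = "Poly_Mapping.single i (1::nat)"
  \<comment> \<open>Subtraction of exponents is truncated; where the two orders of subtracting and
    adding differ, the exponent of i in p is 0 and so is the coefficient.\<close>
  have shift: "Poly_Mapping.single (p - ?e + q) (of_nat (Poly_Mapping.lookup p i) * u) =
      Poly_Mapping.single (p + q - ?e) (of_nat (Poly_Mapping.lookup p i) * u)" for p q and u :: 'k
  proof (cases "Poly_Mapping.lookup p i = 0")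
    case False
    then have "p - ?e + q = p + q - ?e"
      by (auto simp: poly_mapping_eq_iff fun_eq_iff lookup_add lookup_minus lookup_single when_def)
    then show ?thesis by simp
  qed simp
  show ?thesis
    using shift[of a b "c * d"] shift[of b a "c * d"]
    by (simp add: mult_single partial_deriv_single lookup_add single_add[symmetric] algebra_simps)
qed

lemma partial_deriv_mult:
  "partial_deriv i (f * g) = partial_deriv i f * g + f * partial_deriv i g"
proof (induction f rule: mpoly_induct)
  case (single a c)
  show ?case
    by (induction g rule: mpoly_induct)
      (simp_all add: partial_deriv_mult_single partial_deriv_add algebra_simps)
qed (simp_all add: partial_deriv_add algebra_simps)

lemma lookup_var_mult:
  "Poly_Mapping.lookup (var i * f) (c + Poly_Mapping.single i 1) = Poly_Mapping.lookup f c"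
proof (induction f rule: mpoly_induct)
  case (single a d)
  have "Poly_Mapping.single i 1 + a = c + Poly_Mapping.single i 1 \<longleftrightarrow> a = c"
    by (simp add: add.commute)
  then show ?case
    by (simp add: var_def mult_single lookup_single when_def)
qed (simp_all add: lookup_add algebra_simps)

lemma lookup_var_mult_eq_0:
  "Poly_Mapping.lookup c i = 0 \<Longrightarrow> Poly_Mapping.lookup (var i * f) c = 0"
proof (induction f rule: mpoly_induct)
  case (single a d)
  then show ?case
    by (auto simp: var_def mult_single lookup_single when_def lookup_add)
qed (simp_all add: lookup_add algebra_simps)

lemma var_mult_cancel: "var i * f = var i * g \<longleftrightarrow> f = g"
  by (metis lookup_var_mult poly_mapping_eqI)

text \<open>Monomials are eigenvectors of x_i d_i. Euler's identity and the support-shrinking step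
  in \<open>moment_nondegenerate\<close> both rest on this.\<close>

lemma lookup_var_mult_partial_deriv:
  "Poly_Mapping.lookup (var i * partial_deriv i f) a =
    of_nat (Poly_Mapping.lookup a i) * Poly_Mapping.lookup f a"
proof (cases "Poly_Mapping.lookup a i = 0")
  case True
  then show ?thesis by (simp add: lookup_var_mult_eq_0)
next
  case False
  define c where "c = a - Poly_Mapping.single i 1"
  have "a = c + Poly_Mapping.single i 1"
    using False
    by (auto simp: c_def poly_mapping_eq_iff fun_eq_iff lookup_add lookup_minus lookup_single when_def)
  then show ?thesis
    by (simp add: lookup_var_mult lookup_partial_deriv lookup_add del: One_nat_def)
qed

subsection \<open>Homogeneous polynomials\<close>

text \<open>Forms of degree \<open>e - m\<close>, where a negative degree leaves only \<open>0\<close>.\<close>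

definition codeg :: "nat \<Rightarrow> nat \<Rightarrow> ('n::finite, 'k::field_char_0) mpoly set"
  where "codeg m e = {f. \<forall>a\<in>Poly_Mapping.keys f. mdeg a + m = e}"

lemma mdeg_0 [simp]: "mdeg 0 = 0"
  by (simp add: mdeg_def)

lemma mdeg_add [simp]: "mdeg (a + b) = mdeg a + mdeg b"
  by (simp add: mdeg_def lookup_add sum.distrib)

lemma mdeg_single [simp]: "mdeg (Poly_Mapping.single i m) = m"
  by (simp add: mdeg_def lookup_single when_def)

lemma codeg_iff: "f \<in> codeg m e \<longleftrightarrow> (\<forall>a. Poly_Mapping.lookup f a \<noteq> 0 \<longrightarrow> mdeg a + m = e)"
  by (simp add: codeg_def in_keys_iff Ball_def)

lemma homog_iff: "f \<in> homog m \<longleftrightarrow> (\<forall>a. Poly_Mapping.lookup f a \<noteq> 0 \<longrightarrow> mdeg a = m)"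
  by (simp add: homog_def in_keys_iff Ball_def)

lemma codeg_0_left: "codeg 0 e = homog e"
  by (auto simp: codeg_def homog_def)

lemma codeg_cases:
  assumes "f \<in> codeg m e"
  obtains "f = 0" | "m \<le> e" "f \<in> homog (e - m)"
proof (cases "f = 0")
  case False
  then obtain a where "Poly_Mapping.lookup f a \<noteq> 0"
    by (metis poly_mapping_eqI lookup_zero)
  with assms have "m \<le> e" by (auto simp: codeg_iff)
  moreover have "f \<in> homog (e - m)"
    using assms by (auto simp: codeg_iff homog_iff)
  ultimately show ?thesis using that by blast
qed (use that in blast)

lemma codeg_zero [simp]: "0 \<in> codeg m e"
  and codeg_add: "f \<in> codeg m e \<Longrightarrow> g \<in> codeg m e \<Longrightarrow> f + g \<in> codeg m e"
  and codeg_diff: "f \<in> codeg m e \<Longrightarrow> g \<in> codeg m e \<Longrightarrow> f - g \<in> codeg m e"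
  and codeg_const_mult: "f \<in> codeg m e \<Longrightarrow> const c * f \<in> codeg m e"
  by (auto simp: codeg_iff lookup_add lookup_minus lookup_const_mult) (metis add_0)+

lemma codeg_sum: "(\<And>x. x \<in> A \<Longrightarrow> f x \<in> codeg m e) \<Longrightarrow> (\<Sum>x\<in>A. f x) \<in> codeg m e"
  by (induction A rule: infinite_finite_induct) (auto intro: codeg_add)

lemma codeg_mult:
  assumes "f \<in> homog p" "g \<in> codeg m e"
  shows "f * g \<in> codeg m (p + e)"
  using keys_mult[of f g] assms by (fastforce simp: codeg_def homog_def)

lemmas homog_zero [simp] = codeg_zero[of 0, unfolded codeg_0_left]
lemmas homog_add = codeg_add[of _ 0, unfolded codeg_0_left]
lemmas homog_diff = codeg_diff[of _ 0, unfolded codeg_0_left]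
lemmas homog_const_mult = codeg_const_mult[of _ 0, unfolded codeg_0_left]
lemmas homog_sum = codeg_sum[of _ _ 0, unfolded codeg_0_left]
lemmas homog_mult = codeg_mult[of _ _ _ 0, unfolded codeg_0_left]

lemma single_homog: "Poly_Mapping.single a c \<in> homog (mdeg a)"
  by (simp add: homog_iff lookup_single when_def)

lemma var_homog: "var i \<in> homog 1"
  by (simp add: var_def homog_iff lookup_single when_def)

lemma ell_homog: "ell \<in> homog 1"
  unfolding ell_def by (intro homog_sum var_homog)

lemma ell_power_homog: "ell ^ j \<in> homog j"
proof (induction j)
  case 0
  then show ?case using single_homog[of 0 1] by simp
next
  case (Suc j)
  then show ?case using homog_mult[OF ell_homog] by fastforce
qed

lemma var_mult_homog: "f \<in> homog m \<Longrightarrow> var i * f \<in> homog (Suc m)"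
  using homog_mult[OF var_homog] by fastforce

lemma ell_mult_homog: "f \<in> homog m \<Longrightarrow> ell * f \<in> homog (Suc m)"
  using homog_mult[OF ell_homog] by fastforce

lemma codeg_Suc_Suc: "codeg (Suc m) (Suc e) = codeg m e"
  by (simp add: codeg_def)

text \<open>The forward direction recovers the degree of a quotient v from that of x_i v.\<close>

lemma var_mult_codeg_iff: "var i * f \<in> codeg m (Suc e) \<longleftrightarrow> f \<in> codeg m e"
proof
  assume *: "var i * f \<in> codeg m (Suc e)"
  show "f \<in> codeg m e"
    unfolding codeg_iff
  proof (intro allI impI)
    fix a assume "Poly_Mapping.lookup f a \<noteq> 0"
    then have "Poly_Mapping.lookup (var i * f) (a + Poly_Mapping.single i 1) \<noteq> 0"
      by (simp add: lookup_var_mult del: One_nat_def)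
    with * have "mdeg (a + Poly_Mapping.single i 1) + m = Suc e"
      unfolding codeg_iff by blast
    then show "mdeg a + m = e" by simp
  qed
next
  assume "f \<in> codeg m e"
  then show "var i * f \<in> codeg m (Suc e)"
    using codeg_mult[OF var_homog, of f m e i] by simp
qed

lemma partial_deriv_codeg: "f \<in> codeg m e \<Longrightarrow> partial_deriv i f \<in> codeg (Suc m) e"
  unfolding codeg_iff lookup_partial_deriv by (fastforce simp del: of_nat_Suc)

lemma euler_homog:
  assumes "f \<in> homog m"
  shows "(\<Sum>i\<in>UNIV. var i * partial_deriv i f) = const (of_nat m) * f"
proof (rule poly_mapping_eqI)
  fix a
  have "Poly_Mapping.lookup (\<Sum>i\<in>UNIV. var i * partial_deriv i f) a = of_nat (mdeg a) * Poly_Mapping.lookup f a"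
    by (simp add: lookup_sum lookup_var_mult_partial_deriv mdeg_def sum_distrib_right)
  also have "\<dots> = Poly_Mapping.lookup (const (of_nat m) * f) a"
    using assms by (auto simp: lookup_const_mult homog_iff)
  finally show "Poly_Mapping.lookup (\<Sum>i\<in>UNIV. var i * partial_deriv i f) a = \<dots>" .
qed

subsection \<open>The translation-invariant polynomials\<close>

text \<open>Derivative in the direction (1, ..., 1), the infinitesimal form of translating all
  variables together.\<close>

definition total_deriv :: "('n::finite, 'k::field_char_0) mpoly \<Rightarrow> ('n, 'k) mpoly"
  where "total_deriv f = (\<Sum>i\<in>UNIV. partial_deriv i f)"

lemma total_deriv_0 [simp]: "total_deriv 0 = 0"
  and total_deriv_const [simp]: "total_deriv (const c) = 0"
  and total_deriv_add: "total_deriv (f + g) = total_deriv f + total_deriv g"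
  and total_deriv_diff: "total_deriv (f - g) = total_deriv f - total_deriv g"
  and total_deriv_mult: "total_deriv (f * g) = total_deriv f * g + f * total_deriv g"
  and total_deriv_var [simp]: "total_deriv (var i) = 1"
  by (simp_all add: total_deriv_def partial_deriv_add partial_deriv_diff partial_deriv_mult
      partial_deriv_var sum.distrib sum_subtractf sum_distrib_left sum_distrib_right)

lemma total_deriv_sum: "total_deriv (\<Sum>x\<in>A. f x) = (\<Sum>x\<in>A. total_deriv (f x))"
  by (induction A rule: infinite_finite_induct) (simp_all add: total_deriv_add)

lemma total_deriv_var_power:
  "total_deriv (var i ^ Suc j) = const (of_nat (Suc j)) * var i ^ j"
proof -
  have "total_deriv (var i ^ Suc j) = of_nat (Suc j) * var i ^ j"
  proof (induction j)
    case (Suc j)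
    then show ?case
      by (subst power_Suc) (simp add: total_deriv_mult algebra_simps)
  qed simp
  then show ?thesis by (simp only: const_of_nat)
qed

lemma total_deriv_E': "f \<in> E' \<Longrightarrow> total_deriv f = 0"
  unfolding E'_def
  by (induction rule: subalgebra.induct) (auto simp: total_deriv_add total_deriv_diff total_deriv_mult)

lemma const_in_E': "const c \<in> E'"
  and E'_add: "f \<in> E' \<Longrightarrow> g \<in> E' \<Longrightarrow> f + g \<in> E'"
  and E'_mult: "f \<in> E' \<Longrightarrow> g \<in> E' \<Longrightarrow> f * g \<in> E'"
  and var_diff_in_E': "i \<noteq> last_index \<Longrightarrow> var i - var last_index \<in> E'"
  unfolding E'_def by (blast intro: subalgebra.intros)+

lemma zero_in_E': "0 \<in> E'"
  using const_in_E'[of 0] by simp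

text \<open>Monomials grow one variable at a time, so that each variable can be rewritten as a
  difference plus the last variable.\<close>

lemma mpoly_mult_induct [case_names const add mult]:
  fixes f :: "('n::finite, 'k::field_char_0) mpoly"
  assumes const: "\<And>c. P (const c)"
    and add: "\<And>f g. P f \<Longrightarrow> P g \<Longrightarrow> P (f + g)"
    and mult: "\<And>f i. P f \<Longrightarrow> P (var i * f)"
  shows "P f"
proof (induction f rule: mpoly_induct)
  case zero
  then show ?case using const[of 0] by simp
next
  case (single a c)
  show ?case
  proof (induction "mdeg a" arbitrary: a)
    case 0
    then have "a = 0"
      by (auto simp: mdeg_def poly_mapping_eq_iff fun_eq_iff)
    then show ?case using const[of c] by (simp add: const_def)
  next
    case (Suc m)
    then obtain i where i: "Poly_Mapping.lookup a i \<noteq> 0"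
      by (metis mdeg_def nat.distinct(1) sum.neutral)
    define b where "b = a - Poly_Mapping.single i 1"
    have a: "a = Poly_Mapping.single i 1 + b"
      using i by (auto simp: b_def poly_mapping_eq_iff fun_eq_iff lookup_add lookup_minus
          lookup_single when_def)
    then have "m = mdeg b" using Suc.hyps(2) by simp
    from mult[OF Suc.hyps(1)[OF this], of i] show ?case
      by (simp add: a var_def mult_single)
  qed
qed (rule add)

text \<open>Since x_i = (x_i - x_n) + x_n, the ring is generated over \<open>E'\<close> by the last
  variable. The set \<open>Q\<close> contains the constants and is closed under sums and under
  multiplication by every variable.\<close>

lemma E'_adjoin_last_index:
  fixes f :: "('n::{finite,linorder}, 'k::field_char_0) mpoly"
  shows "\<exists>r c. (\<forall>j. c j \<in> E') \<and> f = (\<Sum>j<r. c j * var last_index ^ j)"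
proof -
  define Q :: "('n, 'k) mpoly set"
    where "Q = {f. \<exists>r c. (\<forall>j. c j \<in> E') \<and> f = (\<Sum>j<r. c j * var last_index ^ j)}"
  have add: "f + g \<in> Q" if f: "f \<in> Q" and g: "g \<in> Q" for f g
  proof -
    obtain r c where c: "\<And>j. c j \<in> E'" and f: "f = (\<Sum>j<r. c j * var last_index ^ j)"
      using f unfolding Q_def by blast
    obtain s e where e: "\<And>j. e j \<in> E'" and g: "g = (\<Sum>j<s. e j * var last_index ^ j)"
      using g unfolding Q_def by blast
    \<comment> \<open>Both expansions are padded with zero coefficients to the common length r +
      s.\<close>
    have pad: "(\<Sum>j<t. h j * var last_index ^ j) =
        (\<Sum>j<r + s. (if j < t then h j else 0) * var last_index ^ j)" if "t \<le> r + s"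
      for t and h :: "nat \<Rightarrow> ('n, 'k) mpoly"
      using that by (intro sum.mono_neutral_cong_left) auto
    have "f + g = (\<Sum>j<r + s. ((if j < r then c j else 0) + (if j < s then e j else 0)) * var last_index ^ j)"
      unfolding f g by (subst (1 2) pad) (auto simp: sum.distrib distrib_right)
    moreover have "(if j < r then c j else 0) + (if j < s then e j else 0) \<in> E'" for j
      using c e by (auto intro: E'_add zero_in_E')
    ultimately show ?thesis unfolding Q_def
      by (intro CollectI exI[of _ "r + s"]
          exI[of _ "\<lambda>j. (if j < r then c j else 0) + (if j < s then e j else 0)"]) simp
  qed
  have last: "var last_index * f \<in> Q" if f: "f \<in> Q" for f
  proof -
    obtain r c where c: "\<And>j. c j \<in> E'" and f: "f = (\<Sum>j<r. c j * var last_index ^ j)"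
      using f unfolding Q_def by blast
    have "var last_index * f = (\<Sum>j<Suc r. (if j = 0 then 0 else c (j - 1)) * var last_index ^ j)"
      unfolding f by (subst sum.lessThan_Suc_shift) (simp add: sum_distrib_left algebra_simps)
    then show ?thesis unfolding Q_def
      using c zero_in_E' by (intro CollectI exI[of _ "Suc r"] exI[of _ "\<lambda>j. if j = 0 then 0 else c (j - 1)"]) simp
  qed
  have E': "h * f \<in> Q" if f: "f \<in> Q" and h: "h \<in> E'" for f h
  proof -
    obtain r c where c: "\<And>j. c j \<in> E'" and f: "f = (\<Sum>j<r. c j * var last_index ^ j)"
      using f unfolding Q_def by blast
    show ?thesis unfolding Q_def
      using c E'_mult[OF h]
      by (intro CollectI exI[of _ r] exI[of _ "\<lambda>j. h * c j"]) (simp add: f sum_distrib_left mult.assoc)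
  qed
  have "f \<in> Q"
  proof (induction f rule: mpoly_mult_induct)
    case (const c)
    show ?case unfolding Q_def
      by (intro CollectI exI[of _ 1] exI[of _ "\<lambda>j. const c"]) (simp add: const_in_E')
  next
    case (mult f i)
    show ?case
    proof (cases "i = last_index")
      case False
      have "var i * f = (var i - var last_index) * f + var last_index * f"
        by (simp add: algebra_simps)
      with mult False show ?thesis
        by (metis add last E' var_diff_in_E')
    qed (use mult last in auto)
  qed (rule add)
  then show ?thesis unfolding Q_def by blast
qed

text \<open>Coefficients in \<open>E'\<close> are constants for this derivation and the last
  variable has derivative 1, so it acts as formal differentiation in that variable.\<close>

lemma total_deriv_E'_sum:
  assumes "\<And>j. c j \<in> E'"
  shows "total_deriv (\<Sum>j<Suc r. c j * var last_index ^ j) =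
    (\<Sum>j<r. (const (of_nat (Suc j)) * c (Suc j)) * var last_index ^ j)"
proof -
  have "total_deriv (c 0 * var last_index ^ 0) = 0"
    using assms[of 0] by (simp add: total_deriv_E')
  moreover have "total_deriv (c (Suc j) * var last_index ^ Suc j) =
      (const (of_nat (Suc j)) * c (Suc j)) * var last_index ^ j" for j
    using total_deriv_E'[OF assms]
    by (subst total_deriv_mult) (simp add: total_deriv_var_power mult_ac del: power_Suc of_nat_Suc)
  ultimately show ?thesis
    unfolding total_deriv_sum by (subst sum.lessThan_Suc_shift) simp
qed

lemma const_mult_eq_0_iff: "const c * f = 0 \<longleftrightarrow> c = 0 \<or> f = 0"
  using const_inverse_mult[of c f] by fastforce

text \<open>The last variable is transcendental over \<open>E'\<close>: differentiating gives a
  shorter relation with coefficients (j + 1) c (j + 1), so by induction only c 0 remains.\<close>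

lemma E'_sum_eq_0:
  assumes "\<And>j. c j \<in> E'" "(\<Sum>j<r. c j * var last_index ^ j) = 0" "j < r"
  shows "c j = 0"
  using assms
proof (induction r arbitrary: c j)
  case (Suc r)
  have "(\<Sum>j<r. (const (of_nat (Suc j)) * c (Suc j)) * var last_index ^ j) = 0"
    using Suc.prems(2) total_deriv_E'_sum[of c r, OF Suc.prems(1)] by simp
  from Suc.IH[OF _ this] have *: "c (Suc j) = 0" if "j < r" for j
    using that E'_mult[OF const_in_E' Suc.prems(1)]
    by (metis const_mult_eq_0_iff of_nat_neq_0)
  have "c 0 = 0"
    using Suc.prems(2) by (subst (asm) sum.lessThan_Suc_shift) (simp add: *)
  with * Suc.prems(3) show ?case by (cases j) auto
qed simp

lemma E'_eq_kernel: "E' = {f. total_deriv f = 0}"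
proof (intro equalityI subsetI CollectI)
  fix f :: "('a, 'b) mpoly" assume "f \<in> {f. total_deriv f = 0}"
  then have D: "total_deriv f = 0" by simp
  obtain r c where c: "\<And>j. c j \<in> E'" and f: "f = (\<Sum>j<r. c j * var last_index ^ j)"
    using E'_adjoin_last_index by metis
  show "f \<in> E'"
  proof (cases r)
    case 0
    then show ?thesis using f zero_in_E' by simp
  next
    case (Suc s)
    have "(\<Sum>j<s. (const (of_nat (Suc j)) * c (Suc j)) * var last_index ^ j) = 0"
      using D f Suc total_deriv_E'_sum[of c s, OF c] by simp
    from E'_sum_eq_0[OF _ this] have *: "c (Suc j) = 0" if "j < s" for j
      using that E'_mult[OF const_in_E' c] by (metis const_mult_eq_0_iff of_nat_neq_0)
    have "f = c 0"
      unfolding f Suc by (subst sum.lessThan_Suc_shift) (simp add: *)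
    then show ?thesis using c by simp
  qed
qed (rule total_deriv_E')

subsection \<open>The lowering operator\<close>

text \<open>The operator sum of x_i d_i^2 + d_i. The form d_i (x_i d_i) of each summand suits
  integration by parts.\<close>

definition lowering :: "('n::finite, 'k::field_char_0) mpoly \<Rightarrow> ('n, 'k) mpoly"
  where "lowering f = (\<Sum>i\<in>UNIV. partial_deriv i (var i * partial_deriv i f))"

lemma lowering_0 [simp]: "lowering 0 = 0"
  and lowering_diff: "lowering (f - g) = lowering f - lowering g"
  and lowering_const_mult: "lowering (const c * f) = const c * lowering f"
  by (simp_all add: lowering_def partial_deriv_diff partial_deriv_const_mult
      sum_subtractf sum_distrib_left right_diff_distrib mult.left_commute)

lemma lowering_codeg: "f \<in> homog m \<Longrightarrow> lowering f \<in> codeg 1 m"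
  unfolding lowering_def
proof (intro codeg_sum)
  fix i assume "f \<in> homog m"
  then have "var i * partial_deriv i f \<in> codeg 1 (Suc m)"
    by (simp add: partial_deriv_codeg var_mult_codeg_iff codeg_0_left[symmetric])
  then have "partial_deriv i (var i * partial_deriv i f) \<in> codeg (Suc 1) (Suc m)"
    by (rule partial_deriv_codeg)
  then show "partial_deriv i (var i * partial_deriv i f) \<in> codeg 1 m"
    by (simp only: codeg_Suc_Suc)
qed

lemma lowering_homog_Suc: "f \<in> homog (Suc m) \<Longrightarrow> lowering f \<in> homog m"
  using lowering_codeg[of f "Suc m"] by (simp add: codeg_Suc_Suc codeg_0_left)

lemma lowering_homog_0: "f \<in> homog 0 \<Longrightarrow> lowering f = 0"
  using lowering_codeg[of f 0] by (auto elim: codeg_cases)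

lemma partial_deriv_ell: "partial_deriv i (ell :: ('n::finite, 'k::field_char_0) mpoly) = 1"
proof -
  have "partial_deriv i (\<Sum>j\<in>A. var j :: ('n, 'k) mpoly) = (\<Sum>j\<in>A. if i = j then 1 else 0)" if "finite A" for A
    using that by (induction A) (simp_all add: partial_deriv_add partial_deriv_var)
  then show ?thesis by (simp add: ell_def)
qed

text \<open>Commutator of \<open>lowering\<close> with multiplication by \<open>ell\<close>: each
  index contributes f + 2 x_i d_i f, and Euler's identity sums these to (n + 2 m) f.\<close>

lemma lowering_ell_mult:
  fixes f :: "('n::finite, 'k::field_char_0) mpoly"
  assumes "f \<in> homog m"
  shows "lowering (ell * f) = ell * lowering f + const (of_nat (2 * m + CARD('n))) * f"
proof -
  have "partial_deriv i (var i * partial_deriv i (ell * f)) =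
      f + 2 * (var i * partial_deriv i f) + ell * partial_deriv i (var i * partial_deriv i f)" for i
    by (simp add: partial_deriv_mult partial_deriv_add partial_deriv_ell partial_deriv_var algebra_simps)
  then have "lowering (ell * f) = of_nat CARD('n) * f
      + 2 * (\<Sum>i\<in>UNIV. var i * partial_deriv i f) + ell * lowering f"
    by (simp add: lowering_def sum.distrib sum_distrib_left)
  then show ?thesis
    unfolding euler_homog[OF assms] const_of_nat by (simp add: algebra_simps)
qed

section \<open>\<open>M\<close> as the kernel of \<open>lowering\<close>\<close>

lemma Phi_inj: "Phi f = Phi g \<longleftrightarrow> f = g"
  by (auto simp: poly_mapping_eq_iff fun_eq_iff lookup_Phi)

lemma Phi_0 [simp]: "Phi 0 = 0"
  using Phi_const_mult[of 0 0] by simp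

lemma Phi_sum: "Phi (\<Sum>x\<in>A. f x) = (\<Sum>x\<in>A. Phi (f x))"
  by (induction A rule: infinite_finite_induct) (simp_all add: Phi_add)

lemma Phi_homog_iff: "Phi f \<in> homog m \<longleftrightarrow> f \<in> homog m"
  by (simp add: homog_iff lookup_Phi)

definition mfact :: "('n::finite \<Rightarrow>\<^sub>0 nat) \<Rightarrow> 'k::field_char_0"
  where "mfact a = (\<Prod>i\<in>UNIV. fact (Poly_Mapping.lookup a i))"

lemma mfact_nonzero [simp]: "mfact a \<noteq> 0"
  by (simp add: mfact_def)

lemma mfact_add_single:
  fixes a :: "'n::finite \<Rightarrow>\<^sub>0 nat"
  shows "(mfact (a + Poly_Mapping.single i 1) :: 'k::field_char_0) =
    of_nat (Suc (Poly_Mapping.lookup a i)) * mfact a"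
proof -
  have "(mfact (a + Poly_Mapping.single i 1) :: 'k) =
      (\<Prod>j\<in>UNIV. (if j = i then of_nat (Suc (Poly_Mapping.lookup a i)) else 1) * fact (Poly_Mapping.lookup a j))"
    unfolding mfact_def by (intro prod.cong) (auto simp: lookup_add lookup_single when_def)
  then show ?thesis
    by (simp add: prod.distrib mfact_def)
qed

text \<open>At exponent c both sides are c! (c_i + 1)^2 times the coefficient of f at c + e_i; on
  the left one factor c_i + 1 comes from the factorial.\<close>

lemma partial_deriv_Phi: "partial_deriv i (Phi f) = Phi (partial_deriv i (var i * partial_deriv i f))"
  by (rule poly_mapping_eqI)
    (simp only: lookup_partial_deriv lookup_Phi mfact_def[symmetric] mfact_add_single lookup_var_mult
      mult_ac)

lemma M_iff: "f \<in> M m \<longleftrightarrow> f \<in> homog m \<and> lowering f = 0"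
proof -
  have "total_deriv (Phi f) = Phi (lowering f)"
    by (simp add: total_deriv_def lowering_def Phi_sum partial_deriv_Phi)
  then have "total_deriv (Phi f) = 0 \<longleftrightarrow> lowering f = 0"
    using Phi_inj[of "lowering f" 0] by simp
  then show ?thesis
    by (auto simp: M_def E'_eq_kernel Phi_homog_iff)
qed

text \<open>
  The substitution \<open>g = (f - ell w) / c\<close> turns the equation for \<open>g\<close> into the same equation
  for \<open>w\<close>, one degree lower and with a larger constant.
\<close>

lemma ell_lowering_surj:
  fixes f :: "('n::finite, 'k::field_char_0) mpoly"
  assumes "f \<in> homog m" "c > 0"
  shows "\<exists>g\<in>homog m. ell * lowering g + const (of_nat c) * g = f"
  using assms
proof (induction m arbitrary: f c)
  case 0
  then have "const (inverse (of_nat c)) * f \<in> homog 0"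
    by (blast intro: homog_const_mult)
  with 0 show ?case
    by (intro bexI[of _ "const (inverse (of_nat c)) * f"]) (simp_all add: lowering_homog_0)
next
  case (Suc m)
  let ?c = "of_nat c :: 'k" and ?d = "2 * m + CARD('n) + c"
  \<comment> \<open>\<open>?d\<close> is the commutator constant in degree m plus c, which makes
    lowering (f - ell w) equal to c w.\<close>
  obtain w where w: "w \<in> homog m" "ell * lowering w + const (of_nat ?d) * w = lowering f"
    using Suc.IH[OF lowering_homog_Suc[OF Suc.prems(1)], of ?d] Suc.prems(2) by auto
  define g where "g = const (inverse ?c) * (f - ell * w)"
  have "lowering (f - ell * w) = const ?c * w"
    by (simp add: lowering_diff lowering_ell_mult[OF w(1)] w(2)[symmetric] const_add algebra_simps)
  then have "lowering g = w"
    using Suc.prems(2) by (simp add: g_def lowering_const_mult)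
  moreover have "g \<in> homog (Suc m)"
    unfolding g_def using Suc.prems(1) w(1) by (intro homog_const_mult homog_diff ell_mult_homog)
  moreover have "const ?c * g = f - ell * w"
    using Suc.prems(2) by (simp add: g_def)
  ultimately show ?case by (intro bexI[of _ g]) simp_all
qed

text \<open>By the commutator, \<open>ell_lowering_surj\<close> with constant 2 p + n solves
  lowering (ell w) = lowering f; then f - ell w is in the kernel.\<close>

lemma homog_decompose:
  fixes f :: "('n::{finite,linorder}, 'k::field_char_0) mpoly"
  assumes "f \<in> homog m"
  obtains g h where "g \<in> M m" "h \<in> codeg 1 m" "f = g + ell * h"
proof (cases m)
  case 0
  with assms show ?thesis
    using that[of f 0] by (simp add: M_iff lowering_homog_0)
next
  case (Suc p)
  obtain w where w: "w \<in> homog p" "ell * lowering w + const (of_nat (2 * p + CARD('n))) * w = lowering f"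
    using ell_lowering_surj[OF lowering_homog_Suc, of f p "2 * p + CARD('n)"] assms Suc by auto
  have "lowering (f - ell * w) = 0"
    by (simp add: lowering_diff lowering_ell_mult[OF w(1)] w(2)[symmetric])
  then have "f - ell * w \<in> M m"
    using assms w(1) Suc by (simp add: M_iff homog_diff ell_mult_homog)
  moreover have "w \<in> codeg 1 m"
    using w(1) Suc by (simp add: codeg_Suc_Suc codeg_0_left)
  ultimately show ?thesis using that[of "f - ell * w" w] by simp
qed

subsection \<open>The moment functional\<close>

text \<open>Algebraic form of the integral of \<open>f exp(- x\<^sub>1 - \<dots> - x\<^sub>n)\<close> over the positive orthant.\<close>

definition moment :: "('n::finite, 'k::field_char_0) mpoly \<Rightarrow> 'k"
  where "moment f = (\<Sum>a\<in>Poly_Mapping.keys f. Poly_Mapping.lookup f a * mfact a)"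

lemma moment_superset:
  "finite A \<Longrightarrow> Poly_Mapping.keys f \<subseteq> A \<Longrightarrow> moment f = (\<Sum>a\<in>A. Poly_Mapping.lookup f a * mfact a)"
  unfolding moment_def by (intro sum.mono_neutral_left) (auto simp: in_keys_iff)

lemma moment_0 [simp]: "moment 0 = 0"
  by (simp add: moment_def)

lemma moment_single: "moment (Poly_Mapping.single a c) = c * mfact a"
  by (subst moment_superset[of "{a}"]) auto

lemma moment_add: "moment (f + g) = moment f + moment g"
  using keys_add[of f g]
  by (subst (1 2 3) moment_superset[of "Poly_Mapping.keys f \<union> Poly_Mapping.keys g"])
    (auto simp: lookup_add sum.distrib algebra_simps)

lemma moment_const_mult: "moment (const c * f) = c * moment f"
  by (subst (1 2) moment_superset[of "Poly_Mapping.keys f"])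
    (auto simp: lookup_const_mult in_keys_iff sum_distrib_left mult.assoc)

lemma moment_diff: "moment (f - g) = moment f - moment g"
  using moment_add[of "f - g" g] by simp

lemma moment_sum: "moment (\<Sum>x\<in>A. f x) = (\<Sum>x\<in>A. moment (f x))"
  by (induction A rule: infinite_finite_induct) (simp_all add: moment_add)

lemma moment_mult_single:
  "moment (f * Poly_Mapping.single b c) = (\<Sum>a\<in>Poly_Mapping.keys f. Poly_Mapping.lookup f a * c * mfact (a + b))"
proof -
  have "moment (f * Poly_Mapping.single b c) =
      moment ((\<Sum>a\<in>Poly_Mapping.keys f. Poly_Mapping.single a (Poly_Mapping.lookup f a)) * Poly_Mapping.single b c)"
    by (simp only: sum_single_lookup)
  then show ?thesis
    by (simp add: sum_distrib_right moment_sum mult_single moment_single)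
qed

text \<open>Integration by parts against exp(- x_i); the factor x_i removes the boundary term at
  0.\<close>

lemma moment_partial_deriv_var:
  fixes f :: "('n::finite, 'k::field_char_0) mpoly"
  shows "moment (partial_deriv i (var i * f)) = moment (var i * f)"
proof (induction f rule: mpoly_induct)
  case (single a c)
  have "var i * Poly_Mapping.single a c = Poly_Mapping.single (a + Poly_Mapping.single i 1) c"
    by (simp add: var_def mult_single add.commute)
  moreover have "(mfact (a + Poly_Mapping.single i 1) :: 'k) = of_nat (Suc (Poly_Mapping.lookup a i)) * mfact a"
    by (rule mfact_add_single)
  ultimately show ?case
    by (simp add: partial_deriv_single moment_single lookup_add)
qed (simp_all add: distrib_left partial_deriv_add moment_add)

text \<open>Integration by parts in every variable: Leibniz gives n copies of f, Euler's identity m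
  more. As m + n is nonzero, factors \<open>ell\<close> can later be dropped from vanishing
  moments.\<close>

lemma moment_ell_mult:
  fixes f :: "('n::finite, 'k::field_char_0) mpoly"
  assumes "f \<in> homog m"
  shows "moment (ell * f) = of_nat (m + CARD('n)) * moment f"
proof -
  have "moment (ell * f) = (\<Sum>i\<in>UNIV. moment (partial_deriv i (var i * f)))"
    by (simp add: ell_def sum_distrib_right moment_sum moment_partial_deriv_var)
  also have "\<dots> = moment (\<Sum>i\<in>UNIV. f + var i * partial_deriv i f)"
    by (simp add: moment_sum partial_deriv_mult partial_deriv_var)
  also have "\<dots> = of_nat CARD('n) * moment f + of_nat m * moment f"
    using moment_const_mult[of "of_nat CARD('n)" f]
    by (simp add: sum.distrib euler_homog[OF assms] moment_add moment_const_mult const_of_nat[of "CARD('n)"])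
  finally show ?thesis by (simp add: algebra_simps)
qed

lemma moment_ell_mult_eq_0_iff: "f \<in> homog m \<Longrightarrow> moment (ell * f) = 0 \<longleftrightarrow> moment f = 0"
  unfolding moment_ell_mult by (simp del: of_nat_add)

lemma moment_ell_power_mult_eq_0_iff:
  "f \<in> homog m \<Longrightarrow> moment (ell ^ j * f) = 0 \<longleftrightarrow> moment f = 0"
proof (induction j)
  case (Suc j)
  then show ?case
    using moment_ell_mult_eq_0_iff[OF homog_mult[OF ell_power_homog[of j] Suc.prems]]
    by (simp add: mult.assoc)
qed simp

text \<open>A Green identity: the difference of the integrands is a sum of derivatives d_i (x_i
  ...), so integration by parts removes d_i and Euler's identity leaves the difference of
  degrees.\<close>

lemma moment_lowering:
  fixes g f :: "('n::finite, 'k::field_char_0) mpoly"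
  assumes "g \<in> homog p" "f \<in> homog q"
  shows "moment (lowering g * f) - moment (g * lowering f) = (of_nat p - of_nat q) * moment (g * f)"
proof -
  have 1: "partial_deriv i (var i * partial_deriv i g) * f - g * partial_deriv i (var i * partial_deriv i f) =
      partial_deriv i (var i * (partial_deriv i g * f - g * partial_deriv i f))" for i
    by (simp add: partial_deriv_mult partial_deriv_diff partial_deriv_var algebra_simps)
  have "moment (lowering g * f) - moment (g * lowering f) =
      (\<Sum>i\<in>UNIV. moment (partial_deriv i (var i * partial_deriv i g) * f
        - g * partial_deriv i (var i * partial_deriv i f)))"
    by (simp add: lowering_def sum_distrib_left sum_distrib_right moment_sum moment_diff sum_subtractf)
  also have "\<dots> = moment ((\<Sum>i\<in>UNIV. var i * partial_deriv i g) * f - g * (\<Sum>i\<in>UNIV. var i * partial_deriv i f))"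
    unfolding 1 moment_partial_deriv_var
    by (simp add: sum_distrib_left sum_distrib_right moment_sum moment_diff sum_subtractf algebra_simps)
  also have "\<dots> = (of_nat p - of_nat q) * moment (g * f)"
    by (simp add: euler_homog[OF assms(1)] euler_homog[OF assms(2)] moment_diff moment_const_mult
        mult.left_commute[of g] mult.assoc left_diff_distrib)
  finally show ?thesis .
qed

text \<open>As lowering g = 0, the Green identity expresses (p - q) moment (g f) by the pairing of g
  with lowering f, which has smaller degree; p - q is nonzero.\<close>

lemma M_orthogonal:
  assumes "g \<in> M p" "f \<in> homog q" "q < p"
  shows "moment (g * f) = 0"
  using assms(2,3)
proof (induction q arbitrary: f)
  case 0
  then show ?case
    using moment_lowering[of g p f 0] assms(1) by (simp add: M_iff lowering_homog_0)
next
  case (Suc q)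
  have "moment (g * lowering f) = 0"
    using Suc by (intro Suc.IH) (auto intro: lowering_homog_Suc)
  then have "((of_nat p :: 'b) - of_nat (Suc q)) * moment (g * f) = 0"
    using moment_lowering[of g p f "Suc q"] assms(1) Suc.prems by (simp add: M_iff)
  with Suc.prems show ?case
    by (simp only: mult_eq_0_iff right_minus_eq of_nat_eq_iff) auto
qed

lemma M_orthogonal_ell:
  assumes "g \<in> M p" "f \<in> homog q" "q < p"
  shows "moment (ell * (g * f)) = 0"
proof -
  have "g \<in> homog p" using assms(1) by (simp add: M_iff)
  then show ?thesis
    using M_orthogonal[OF assms] moment_ell_mult[OF homog_mult[OF _ assms(2)]] by simp
qed

text \<open>
  The radical of the pairing is stable under every \<open>x\<^sub>i \<partial>/\<partial>x\<^sub>i\<close>, hence spanned by monomials;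
  but no monomial has moment zero.
\<close>

lemma moment_nondegenerate:
  assumes "\<And>f. moment (g * f) = 0"
  shows "g = 0"
  using assms
proof (induction "card (Poly_Mapping.keys g)" arbitrary: g rule: less_induct)
  case (less g)
  show ?case
  proof (rule ccontr)
    assume "g \<noteq> 0"
    then obtain a where a: "Poly_Mapping.lookup g a \<noteq> 0"
      by (metis poly_mapping_eqI lookup_zero)
    show False
    proof (cases "\<exists>b. b \<noteq> a \<and> Poly_Mapping.lookup g b \<noteq> 0")
      case True
      then obtain b i where b: "Poly_Mapping.lookup g b \<noteq> 0" and i: "Poly_Mapping.lookup a i \<noteq> Poly_Mapping.lookup b i"
        by (metis poly_mapping_eqI)
      \<comment> \<open>Subtracting the eigenvalue at b removes b from the support and keeps
        a.\<close>
      define h where "h = var i * partial_deriv i g - const (of_nat (Poly_Mapping.lookup b i)) * g"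
      have h: "Poly_Mapping.lookup h c =
          (of_nat (Poly_Mapping.lookup c i) - of_nat (Poly_Mapping.lookup b i)) * Poly_Mapping.lookup g c" for c
        by (simp add: h_def lookup_minus lookup_var_mult_partial_deriv lookup_const_mult left_diff_distrib)
      have "Poly_Mapping.keys h \<subset> Poly_Mapping.keys g"
        using b h[of b] by (auto simp: in_keys_iff h)
      then have "card (Poly_Mapping.keys h) < card (Poly_Mapping.keys g)"
        by (rule psubset_card_mono[rotated]) simp
      moreover have "moment (h * f) = 0" for f
      proof -
        \<comment> \<open>Leibniz and integration by parts move the operator onto f, so h is again
          in the radical.\<close>
        have "var i * partial_deriv i g * f =
            partial_deriv i (var i * (g * f)) - g * f - g * (var i * partial_deriv i f)"
          by (simp add: partial_deriv_mult partial_deriv_var algebra_simps)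
        then have "moment (var i * partial_deriv i g * f) = moment (g * (var i * f)) - moment (g * f) - moment (g * (var i * partial_deriv i f))"
          by (simp add: moment_diff moment_partial_deriv_var mult.left_commute[of g "var i"])
        then show ?thesis
          by (simp add: h_def left_diff_distrib moment_diff mult.assoc moment_const_mult less.prems)
      qed
      ultimately have "h = 0" by (rule less.hyps)
      with h[of a] a i show False by simp
    next
      case False
      then have "g = Poly_Mapping.single a (Poly_Mapping.lookup g a)"
        by (intro poly_mapping_eqI) (auto simp: lookup_single when_def)
      then have "moment g \<noteq> 0"
        using a by (metis moment_single mfact_nonzero mult_eq_0_iff)
      with less.prems[of 1] show False by simp
    qed
  qed
qed

text \<open>Degrees below m are covered by \<open>M_orthogonal\<close>, degree m by hypothesis, and
  higher degrees by climbing with the Green identity. So g pairs to zero with everything.\<close>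

lemma M_nondegenerate:
  assumes g: "g \<in> M m" and orth: "\<And>f. f \<in> homog m \<Longrightarrow> moment (g * f) = 0"
  shows "g = 0"
proof -
  have homog: "moment (g * f) = 0" if "f \<in> homog q" for f q
    using that
  proof (induction q arbitrary: f)
    case 0
    then show ?case using orth M_orthogonal[OF g] by (cases "m = 0") auto
  next
    case (Suc q)
    show ?case
    proof (cases "Suc q \<le> m")
      case True
      then show ?thesis using Suc.prems orth M_orthogonal[OF g] by (cases "Suc q = m") auto
    next
      case False
      have "moment (g * lowering f) = 0"
        using Suc by (auto intro: lowering_homog_Suc)
      then have "((of_nat m :: 'b) - of_nat (Suc q)) * moment (g * f) = 0"
        using moment_lowering[of g m f "Suc q"] g Suc.prems by (simp add: M_iff)
      with False show ?thesis
        by (simp only: mult_eq_0_iff right_minus_eq of_nat_eq_iff) auto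
    qed
  qed
  have "moment (g * f) = 0" for f
    by (induction f rule: mpoly_induct) (auto simp: distrib_left moment_add intro: homog single_homog)
  then show ?thesis by (rule moment_nondegenerate)
qed

text \<open>With g = g0 + ell h, testing against multiples of \<open>ell\<close> isolates h, since
  g0 is orthogonal to lower degree. By induction h = 0, leaving g in \<open>M\<close>.\<close>

lemma homog_nondegenerate_eq:
  fixes g :: "('n::{finite,linorder}, 'k::field_char_0) mpoly"
  assumes "g \<in> homog m" "\<And>f. f \<in> homog m \<Longrightarrow> moment (g * f) = 0"
  shows "g = 0"
  using assms
proof (induction m arbitrary: g)
  case 0
  then show ?case by (intro M_nondegenerate[of g 0]) (auto simp: M_iff lowering_homog_0)
next
  case (Suc m)
  obtain g0 h where g0: "g0 \<in> M (Suc m)" and h: "h \<in> homog m" and g: "g = g0 + ell * h"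
    using homog_decompose[OF Suc.prems(1)] by (metis One_nat_def codeg_Suc_Suc codeg_0_left)
  have "moment (h * f) = 0" if f: "f \<in> homog m" for f
  proof -
    have "moment (g * (ell * f)) = 0"
      using Suc.prems(2) ell_mult_homog[OF f] by blast
    moreover have "g * (ell * f) = ell * (g0 * f) + ell ^ 2 * (h * f)"
      by (simp add: g power2_eq_square algebra_simps)
    moreover have "moment (ell * (g0 * f)) = 0"
      using M_orthogonal_ell[OF g0 f] by simp
    ultimately show ?thesis
      using moment_ell_power_mult_eq_0_iff[OF homog_mult[OF h f], of 2] by (simp add: moment_add)
  qed
  with Suc.IH[OF h] have "h = 0" by blast
  with g g0 Suc.prems show ?case by (auto intro: M_nondegenerate)
qed

text \<open>Test forms of degree m are raised to degree p by a power of \<open>ell\<close>, which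
  does not affect vanishing of moments.\<close>

lemma homog_nondegenerate:
  fixes g :: "('n::{finite,linorder}, 'k::field_char_0) mpoly"
  assumes "g \<in> homog m" "m \<le> p" "\<And>f. f \<in> homog p \<Longrightarrow> moment (g * f) = 0"
  shows "g = 0"
proof (rule homog_nondegenerate_eq[OF assms(1)])
  fix f :: "('n, 'k) mpoly" assume f: "f \<in> homog m"
  have "ell ^ (p - m) * f \<in> homog p"
    using homog_mult[OF ell_power_homog f, of "p - m"] assms(2) by simp
  then have "moment (ell ^ (p - m) * (g * f)) = 0"
    using assms(3) by (metis mult.left_commute)
  then show "moment (g * f) = 0"
    using moment_ell_power_mult_eq_0_iff[OF homog_mult[OF assms(1) f]] by blast
qed

text \<open>A converse to \<open>M_orthogonal\<close> that needs only degree m: in g = g0 + ell h,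
  the part h is orthogonal to its own degree, hence 0.\<close>

lemma orthogonal_imp_M:
  assumes "g \<in> homog (Suc m)" "\<And>f. f \<in> homog m \<Longrightarrow> moment (g * f) = 0"
  shows "g \<in> M (Suc m)"
proof -
  obtain g0 h where g0: "g0 \<in> M (Suc m)" and h: "h \<in> homog m" and g: "g = g0 + ell * h"
    using homog_decompose[OF assms(1)] by (metis One_nat_def codeg_Suc_Suc codeg_0_left)
  have "moment (h * f) = 0" if f: "f \<in> homog m" for f
  proof -
    have "moment (ell * (h * f)) = 0"
      using assms(2)[OF f] M_orthogonal[OF g0 f] by (simp add: g distrib_right moment_add mult.assoc)
    then show ?thesis using moment_ell_mult_eq_0_iff[OF homog_mult[OF h f]] by blast
  qed
  with h have "h = 0" by (blast intro: homog_nondegenerate_eq)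
  with g g0 show ?thesis by simp
qed

subsection \<open>The annihilator of a complete symmetric polynomial\<close>

text \<open>All coefficients of \<open>hsym e\<close> in degree e are 1, so differentiation leaves
  only the quotients (a + c)! / c!. This is how \<open>moment\<close> enters.\<close>

lemma lookup_act_hsym:
  fixes g :: "('n::{finite,linorder}, 'k::field_char_0) mpoly"
  shows "Poly_Mapping.lookup (g \<circle> hsym e) c =
    (\<Sum>a\<in>Poly_Mapping.keys g. if mdeg c + mdeg a = e then Poly_Mapping.lookup g a * mfact (a + c) / mfact c else 0)"
proof -
  have fact: "(fact (x + y) :: 'k) = pochhammer (of_nat (Suc y)) x * fact y" for x y
    by (simp add: pochhammer_fact pochhammer_product' add.commute[of x] mult.commute)
  have "(\<Prod>i\<in>UNIV. pochhammer (of_nat (Suc (Poly_Mapping.lookup c i))) (Poly_Mapping.lookup a i)) =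
      (mfact (a + c) / mfact c :: 'k)" for a
    unfolding mfact_def lookup_add prod_dividef[symmetric]
    by (intro prod.cong refl) (simp add: fact)
  then show ?thesis
    by (auto simp: lookup_act lookup_monom_deriv lookup_hsym intro!: sum.cong)
qed

lemma ann_hsym_iff_monomials:
  fixes g :: "('n::{finite,linorder}, 'k::field_char_0) mpoly"
  assumes "g \<in> homog m"
  shows "g \<in> ann (hsym e) \<longleftrightarrow> (\<forall>c. mdeg c + m = e \<longrightarrow> moment (g * Poly_Mapping.single c 1) = 0)"
proof -
  have deg: "mdeg a = m" if "a \<in> Poly_Mapping.keys g" for a
    using assms that by (simp add: homog_def)
  have eq: "mfact c * Poly_Mapping.lookup (g \<circle> hsym e) c =
      (if mdeg c + m = e then moment (g * Poly_Mapping.single c 1) else 0)" for c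
    by (auto simp: lookup_act_hsym moment_mult_single sum_distrib_left deg intro!: sum.cong)
  have "g \<in> ann (hsym e) \<longleftrightarrow> (\<forall>c. mfact c * Poly_Mapping.lookup (g \<circle> hsym e) c = 0)"
    by (simp add: ann_def poly_mapping_eq_iff fun_eq_iff)
  then show ?thesis unfolding eq by auto
qed

text \<open>For m > e the only test form is 0, in accordance with every form of degree above e
  annihilating \<open>hsym e\<close>.\<close>

lemma ann_hsym_iff:
  fixes g :: "('n::{finite,linorder}, 'k::field_char_0) mpoly"
  assumes "g \<in> homog m"
  shows "g \<in> ann (hsym e) \<longleftrightarrow> (\<forall>u\<in>codeg m e. moment (g * u) = 0)"
  unfolding ann_hsym_iff_monomials[OF assms]
proof (intro iffI ballI allI impI)
  fix u :: "('n, 'k) mpoly"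
  assume *: "\<forall>c. mdeg c + m = e \<longrightarrow> moment (g * Poly_Mapping.single c 1) = 0" and u: "u \<in> codeg m e"
  have "Poly_Mapping.single c (Poly_Mapping.lookup u c) =
      const (Poly_Mapping.lookup u c) * Poly_Mapping.single c 1" for c
    by (simp add: const_def mult_single)
  then have "g * u = g * (\<Sum>c\<in>Poly_Mapping.keys u. const (Poly_Mapping.lookup u c) * Poly_Mapping.single c 1)"
    using sum_single_lookup[of u] by simp
  then have "moment (g * u) =
      (\<Sum>c\<in>Poly_Mapping.keys u. Poly_Mapping.lookup u c * moment (g * Poly_Mapping.single c 1))"
    by (simp add: sum_distrib_left mult.left_commute[of g] moment_sum moment_const_mult)
  also have "\<dots> = 0"
    using * u by (auto simp: codeg_def intro!: sum.neutral)
  finally show "moment (g * u) = 0" .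
next
  fix c :: "'n \<Rightarrow>\<^sub>0 nat" assume "\<forall>u\<in>codeg m e. moment (g * u) = 0" and "mdeg c + m = e"
  then show "moment (g * Poly_Mapping.single c 1) = 0"
    by (simp add: codeg_def)
qed

section \<open>Homogeneous components\<close>

definition hcomp :: "nat \<Rightarrow> ('n::finite, 'k::field_char_0) mpoly \<Rightarrow> ('n, 'k) mpoly"
  where "hcomp m g = (\<Sum>a | a \<in> Poly_Mapping.keys g \<and> mdeg a = m. Poly_Mapping.single a (Poly_Mapping.lookup g a))"

lemma lookup_hcomp: "Poly_Mapping.lookup (hcomp m g) a = (if mdeg a = m then Poly_Mapping.lookup g a else 0)"
  by (auto simp: hcomp_def lookup_sum lookup_single when_def in_keys_iff)

lemma hcomp_homog: "hcomp m g \<in> homog m"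
  by (simp add: homog_iff lookup_hcomp)

lemma sum_hcomp: "(\<Sum>m\<in>mdeg ` Poly_Mapping.keys g. hcomp m g) = g"
  by (rule poly_mapping_eqI) (auto simp: lookup_sum lookup_hcomp in_keys_iff)

text \<open>As \<open>hsym e\<close> is homogeneous, different components of g contribute to
  different degrees of the result.\<close>

lemma hcomp_ann_hsym:
  assumes "g \<in> ann (hsym e)"
  shows "hcomp m g \<in> ann (hsym e)"
proof -
  have "Poly_Mapping.lookup (hcomp m g \<circle> hsym e) c =
      (if mdeg c + m = e then Poly_Mapping.lookup (g \<circle> hsym e) c else 0)" for c
  proof -
    have keys: "Poly_Mapping.keys (hcomp m g) = {a \<in> Poly_Mapping.keys g. mdeg a = m}"
      by (auto simp: in_keys_iff lookup_hcomp split: if_splits)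
    show ?thesis
      unfolding lookup_act_hsym keys
      by (auto simp: lookup_hcomp sum.inter_filter intro!: sum.neutral sum.cong)
  qed
  with assms show ?thesis
    by (simp add: ann_def poly_mapping_eq_iff fun_eq_iff)
qed

lemma ann_add: "g \<in> ann f \<Longrightarrow> h \<in> ann f \<Longrightarrow> g + h \<in> ann f"
  by (simp add: ann_def act_add_left)

lemma zero_in_ann: "0 \<in> ann f"
  by (simp add: ann_def act_def)

lemma ann_mult: "h \<in> ann f \<Longrightarrow> g * h \<in> ann f"
  using act_sum_right[of g "\<lambda>_. 0" "{}"] by (simp add: ann_def act_mult)

subsection \<open>Linear forms\<close>

context vector_space
begin

lemma linear_form_iff:
  "Vector_Spaces.linear scale (*) \<phi> \<longleftrightarrow> (\<forall>x y. \<phi> (x + y) = \<phi> x + \<phi> y) \<and> (\<forall>c x. \<phi> (scale c x) = c * \<phi> x)"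
proof -
  have "vector_space ((*) :: 'a \<Rightarrow> 'a \<Rightarrow> 'a)"
    by unfold_locales (auto simp: algebra_simps)
  then show ?thesis
    using vector_space_axioms by (auto simp: Vector_Spaces.linear_iff)
qed

lemma separating_linear_form:
  assumes W: "subspace W" and x: "x \<notin> W"
  obtains \<phi> where "Vector_Spaces.linear scale (*) \<phi>" "\<And>w. w \<in> W \<Longrightarrow> \<phi> w = 0" "\<phi> x = 1"
proof -
  interpret K: vector_space "(*) :: 'a \<Rightarrow> 'a \<Rightarrow> 'a"
    by unfold_locales (auto simp: algebra_simps)
  interpret P: vector_space_pair scale "(*) :: 'a \<Rightarrow> 'a \<Rightarrow> 'a" ..
  obtain B where B: "B \<subseteq> W" "independent B" "W \<subseteq> span B"
    by (rule maximal_independent_subset)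
  then have span: "span B = W"
    using W by (simp add: span_minimal subset_antisym)
  have "independent (insert x B)"
    using B(2) x span by (simp add: independent_insertI)
  from P.linear_independent_extend[OF this, of "\<lambda>y. if y = x then 1 else 0"]
  obtain \<phi> where \<phi>: "Vector_Spaces.linear scale (*) \<phi>" "\<forall>y\<in>insert x B. \<phi> y = (if y = x then 1 else 0)"
    by blast
  have "\<phi> w = 0" if "w \<in> W" for w
    using \<phi> x B(1) that span by (intro P.linear_eq_0_on_span[of \<phi> B w]) auto
  with \<phi> that show ?thesis by simp
qed

text \<open>A form vanishing on the common kernel of finitely many forms is a combination of them.
  The forms are treated one at a time.\<close>

lemma linear_form_combination:
  assumes "finite C" and V: "subspace V"
    and F: "\<And>c. c \<in> C \<Longrightarrow> Vector_Spaces.linear scale (*) (F c)"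
    and \<psi>: "Vector_Spaces.linear scale (*) \<psi>"
    and ker: "\<And>p. p \<in> V \<Longrightarrow> (\<And>c. c \<in> C \<Longrightarrow> F c p = 0) \<Longrightarrow> \<psi> p = 0"
  shows "\<exists>w. \<forall>p\<in>V. \<psi> p = (\<Sum>c\<in>C. w c * F c p)"
  using assms(1) F \<psi> ker
proof (induction C arbitrary: \<psi>)
  case empty
  then show ?case by simp
next
  case (insert c C)
  have sum: "(\<Sum>b\<in>insert c C. (w(c := t)) b * F b p) = t * F c p + (\<Sum>b\<in>C. w b * F b p)" for w t p
  proof -
    have "(\<Sum>b\<in>C. (w(c := t)) b * F b p) = (\<Sum>b\<in>C. w b * F b p)"
      using insert.hyps(2) by (intro sum.cong) auto
    then show ?thesis by (simp only: sum.insert[OF insert.hyps] fun_upd_same)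
  qed
  show ?case
  proof (cases "\<exists>p\<in>V. (\<forall>b\<in>C. F b p = 0) \<and> F c p \<noteq> 0")
    case True
    then obtain p where p: "p \<in> V" "\<And>b. b \<in> C \<Longrightarrow> F b p = 0" "F c p \<noteq> 0" by blast
    \<comment> \<open>This value makes \<open>\<psi>'\<close> vanish at p, the vector on which only
      F c is nonzero.\<close>
    define t where "t = \<psi> p / F c p"
    define \<psi>' where "\<psi>' = (\<lambda>q. \<psi> q - t * F c q)"
    have "\<psi>' q = 0" if q: "q \<in> V" and Fq: "\<And>b. b \<in> C \<Longrightarrow> F b q = 0" for q
    proof -
      \<comment> \<open>Correcting q along p puts it into the kernel of F c as well.\<close>
      define q' where "q' = q + scale (- (F c q / F c p)) p"
      have "q' \<in> V"
        unfolding q'_def using q p(1) V by (intro subspace_add subspace_scale)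
      moreover have "F b q' = 0" if "b \<in> insert c C" for b
      proof -
        have "F b q' = F b q + - (F c q / F c p) * F b p"
          using insert.prems(1)[OF that] unfolding q'_def linear_form_iff by metis
        then show ?thesis using that p(2,3) Fq by auto
      qed
      ultimately have "\<psi> q' = 0" using insert.prems(3) by blast
      moreover have "\<psi> q' = \<psi> q + - (F c q / F c p) * \<psi> p"
        using insert.prems(2) unfolding q'_def linear_form_iff by metis
      ultimately show ?thesis by (simp add: \<psi>'_def t_def)
    qed
    moreover have "Vector_Spaces.linear scale (*) \<psi>'"
      using insert.prems(1)[of c] insert.prems(2)
      by (simp add: linear_form_iff \<psi>'_def algebra_simps)
    ultimately obtain w where w: "\<forall>p\<in>V. \<psi>' p = (\<Sum>c\<in>C. w c * F c p)"
      using insert.IH[of \<psi>'] insert.prems(1) by auto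
    then have "\<forall>p\<in>V. \<psi> p = (\<Sum>b\<in>insert c C. (w(c := t)) b * F b p)"
      unfolding sum by (simp add: \<psi>'_def algebra_simps)
    then show ?thesis by blast
  next
    case False
    then have "\<psi> p = 0" if "p \<in> V" "\<And>b. b \<in> C \<Longrightarrow> F b p = 0" for p
      using that insert.prems(3)[of p] by blast
    then obtain w where "\<forall>p\<in>V. \<psi> p = (\<Sum>c\<in>C. w c * F c p)"
      using insert.IH[of \<psi>] insert.prems(1,2) by auto
    then have "\<forall>p\<in>V. \<psi> p = (\<Sum>b\<in>insert c C. (w(c := 0)) b * F b p)"
      unfolding sum by simp
    then show ?thesis by blast
  qed
qed

end

global_interpretation mpoly: vector_space "\<lambda>(c :: 'k::field_char_0) (f :: ('n, 'k) mpoly). const c * f"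
  by unfold_locales (auto simp: const_add const_mult algebra_simps)

abbreviation linear_form :: "(('n, 'k::field_char_0) mpoly \<Rightarrow> 'k) \<Rightarrow> bool"
  where "linear_form \<equiv> Vector_Spaces.linear (\<lambda>c f. const c * f) (*)"

lemma linear_form_add: "linear_form \<phi> \<Longrightarrow> \<phi> (f + g) = \<phi> f + \<phi> g"
  and linear_form_const_mult: "linear_form \<phi> \<Longrightarrow> \<phi> (const c * f) = c * \<phi> f"
  by (simp_all add: mpoly.linear_form_iff)

lemma linear_form_0: "linear_form \<phi> \<Longrightarrow> \<phi> 0 = 0"
  using linear_form_const_mult[of \<phi> 0 0] by simp

lemma linear_form_sum: "linear_form \<phi> \<Longrightarrow> \<phi> (\<Sum>x\<in>A. f x) = (\<Sum>x\<in>A. \<phi> (f x))"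
  by (induction A rule: infinite_finite_induct) (simp_all add: linear_form_0 linear_form_add)

text \<open>In degree m the annihilator is the common kernel of the pairings with the finitely many
  monomials of complementary degree; the weights of the resulting combination are the coefficients
  of u.\<close>

lemma ann_hsym_linear_form:
  fixes \<psi> :: "('n::{finite,linorder}, 'k::field_char_0) mpoly \<Rightarrow> 'k"
  assumes \<psi>: "linear_form \<psi>" and ker: "\<And>p. p \<in> homog m \<Longrightarrow> p \<in> ann (hsym e) \<Longrightarrow> \<psi> p = 0"
  shows "\<exists>u\<in>codeg m e. \<forall>p\<in>homog m. \<psi> p = moment (p * u)"
proof -
  define C where "C = {c :: 'n \<Rightarrow>\<^sub>0 nat. mdeg c + m = e}"
  have "finite C"
    unfolding C_def using finite_mdeg_eq[of "e - m"] by (rule finite_subset[rotated]) auto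
  moreover have "mpoly.subspace (homog m :: ('n, 'k) mpoly set)"
    by (simp add: mpoly.subspace_def homog_add homog_const_mult)
  moreover have "linear_form (\<lambda>p. moment (p * Poly_Mapping.single c 1))" for c :: "'n \<Rightarrow>\<^sub>0 nat"
    by (simp add: mpoly.linear_form_iff distrib_right moment_add mult.assoc moment_const_mult)
  ultimately have "\<exists>w. \<forall>p\<in>homog m. \<psi> p = (\<Sum>c\<in>C. w c * moment (p * Poly_Mapping.single c 1))"
    using \<psi> ker by (intro mpoly.linear_form_combination) (auto simp: C_def ann_hsym_iff_monomials)
  then obtain w where w: "\<forall>p\<in>homog m. \<psi> p = (\<Sum>c\<in>C. w c * moment (p * Poly_Mapping.single c 1))"
    by blast
  define u where "u = (\<Sum>c\<in>C. const (w c) * Poly_Mapping.single c 1)"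
  have "u \<in> codeg m e"
    unfolding u_def C_def by (intro codeg_sum codeg_const_mult) (simp add: codeg_def)
  moreover have "moment (p * u) = (\<Sum>c\<in>C. w c * moment (p * Poly_Mapping.single c 1))" for p
    by (simp add: u_def sum_distrib_left mult.left_commute[of p] moment_sum moment_const_mult)
  ultimately show ?thesis using w by (intro bexI[of _ u]) simp_all
qed

subsection \<open>Generators of the annihilator\<close>

lemma M_sum: "(\<And>x. x \<in> A \<Longrightarrow> f x \<in> M m) \<Longrightarrow> (\<Sum>x\<in>A. f x) \<in> M m"
  by (induction A rule: infinite_finite_induct) (auto intro: M_add zero_in_M)

text \<open>For distinct i and j, x_i divides x_j u_i and therefore u_i. The quotient v serves every
  index k, since x_i u_k = x_k u_i = x_i x_k v.\<close>

lemma var_quotient: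
  fixes u :: "'n::finite \<Rightarrow> ('n, 'k::field_char_0) mpoly"
  assumes "CARD('n) \<ge> 2" and u: "\<And>i j. var j * u i = var i * u j"
  obtains v where "\<And>i. u i = var i * v"
proof -
  obtain i j :: 'n where "i \<noteq> j"
    using assms(1) by (metis One_nat_def Suc_1 card_le_Suc0_iff_eq finite_class.finite_UNIV not_less_eq_eq UNIV_I)
  have zero: "Poly_Mapping.lookup (u i) a = 0" if "Poly_Mapping.lookup a i = 0" for a
  proof -
    have "Poly_Mapping.lookup (u i) a = Poly_Mapping.lookup (var i * u j) (a + Poly_Mapping.single j 1)"
      unfolding u[of j i, symmetric] by (rule lookup_var_mult[symmetric])
    also have "\<dots> = 0"
      using that \<open>i \<noteq> j\<close> by (intro lookup_var_mult_eq_0) (simp add: lookup_add lookup_single when_def)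
    finally show ?thesis .
  qed
  define e where "e = Poly_Mapping.single i (1::nat)"
  define v where "v = (\<Sum>b\<in>Poly_Mapping.keys (u i). Poly_Mapping.single (b - e) (Poly_Mapping.lookup (u i) b))"
  have "var i * Poly_Mapping.single (b - e) c = Poly_Mapping.single b c"
    if "b \<in> Poly_Mapping.keys (u i)" for b and c :: 'k
  proof -
    have "Poly_Mapping.lookup b i \<noteq> 0" using that zero by (auto simp: in_keys_iff)
    then have "e + (b - e) = b"
      by (auto simp: e_def poly_mapping_eq_iff fun_eq_iff lookup_add lookup_minus lookup_single when_def)
    then show ?thesis by (simp add: var_def mult_single e_def)
  qed
  then have "var i * v = u i"
    by (simp add: v_def sum_distrib_left sum_single_lookup)
  then have "u k = var k * v" for k
    using u[of i k] by (metis mult.left_commute var_mult_cancel)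
  then show ?thesis by (rule that)
qed

section \<open>Ideals, and separating a form from an ideal\<close>

definition is_ideal :: "'a::comm_ring_1 set \<Rightarrow> bool"
  where "is_ideal I \<longleftrightarrow> module.subspace (*) I"

lemma is_idealD:
  assumes "is_ideal I"
  shows "0 \<in> I" "f \<in> I \<Longrightarrow> g \<in> I \<Longrightarrow> f + g \<in> I" "g \<in> I \<Longrightarrow> f * g \<in> I"
  using assms by (auto simp: is_ideal_def module.subspace_def[OF module_times])

lemma is_ideal_ideal_of: "is_ideal (ideal_of A)"
  unfolding is_ideal_def ideal_of_def by (rule module.subspace_span[OF module_times])

lemma is_ideal_ann: "is_ideal (ann f)"
  by (simp add: is_ideal_def module.subspace_def[OF module_times] ann_add zero_in_ann ann_mult)

lemma ideal_of_base: "f \<in> A \<Longrightarrow> f \<in> ideal_of A"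
  unfolding ideal_of_def by (rule module.span_base[OF module_times])

lemma ideal_of_minimal: "A \<subseteq> I \<Longrightarrow> is_ideal I \<Longrightarrow> ideal_of A \<subseteq> I"
  unfolding ideal_of_def is_ideal_def by (rule module.span_minimal[OF module_times])

text \<open>A linear form kills I but not g. As I contains the annihilator in degree m, each p ->
  phi (x_i p) is a pairing. The last clause says that no v divides all u_i simultaneously, which
  later proofs contradict.\<close>

lemma separating_family:
  fixes g :: "('n::{finite,linorder}, 'k::field_char_0) mpoly"
  assumes I: "is_ideal I" and low: "homog m \<inter> ann (hsym e) \<subseteq> I"
    and g: "g \<in> homog (Suc m)" "g \<in> ann (hsym e)" "g \<notin> I"
  obtains \<phi> u where "linear_form \<phi>" "\<And>f. f \<in> I \<Longrightarrow> \<phi> f = 0" "\<And>i. u i \<in> codeg m e"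
    "\<And>i p. p \<in> homog m \<Longrightarrow> \<phi> (var i * p) = moment (p * u i)"
    "\<And>v. v \<in> codeg (Suc m) e \<Longrightarrow> (\<And>i. u i = var i * v) \<Longrightarrow> False"
proof -
  have "mpoly.subspace I"
    using is_idealD[OF I] by (simp add: mpoly.subspace_def)
  then obtain \<phi> where \<phi>: "linear_form \<phi>" "\<And>f. f \<in> I \<Longrightarrow> \<phi> f = 0" "\<phi> g = 1"
    using mpoly.separating_linear_form g(3) by metis
  have "\<exists>u\<in>codeg m e. \<forall>p\<in>homog m. \<phi> (var i * p) = moment (p * u)" for i
  proof (rule ann_hsym_linear_form)
    show "linear_form (\<lambda>p. \<phi> (var i * p))"
      using \<phi>(1) by (simp add: mpoly.linear_form_iff distrib_left mult.left_commute[of "var i"])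
    show "\<phi> (var i * p) = 0" if "p \<in> homog m" "p \<in> ann (hsym e)" for p
      using that low \<phi>(2) is_idealD(3)[OF I] by blast
  qed
  then obtain u where u: "\<And>i. u i \<in> codeg m e" "\<And>i p. p \<in> homog m \<Longrightarrow> \<phi> (var i * p) = moment (p * u i)"
    by metis
  have False if v: "v \<in> codeg (Suc m) e" and uv: "\<And>i. u i = var i * v" for v
  proof -
    have d: "partial_deriv i g \<in> homog m" for i
      using partial_deriv_codeg[of g 0 "Suc m" i] g(1) by (simp add: codeg_0_left codeg_Suc_Suc)
    \<comment> \<open>Euler's identity writes a multiple of g through products x_i p, where phi is
      known; phi g would then be a multiple of moment (g v) = 0.\<close>
    have "of_nat (Suc m) * \<phi> g = \<phi> (\<Sum>i\<in>UNIV. var i * partial_deriv i g)"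
      unfolding euler_homog[OF g(1)] by (rule linear_form_const_mult[OF \<phi>(1), symmetric])
    also have "\<dots> = (\<Sum>i\<in>UNIV. moment (var i * partial_deriv i g * v))"
      by (simp add: linear_form_sum[OF \<phi>(1)] u(2)[OF d] uv algebra_simps)
    also have "\<dots> = moment (const (of_nat (Suc m)) * g * v)"
      by (simp only: euler_homog[OF g(1), symmetric] sum_distrib_right moment_sum)
    also have "\<dots> = 0"
      using g v by (simp add: ann_hsym_iff mult.assoc moment_const_mult)
    finally show False using \<phi>(3) by (simp del: of_nat_Suc)
  qed
  with \<phi> u that show ?thesis by blast
qed

text \<open>phi (x_i x_j q) is evaluated in two ways.\<close>

lemma separating_family_cross:
  assumes "\<And>i p. p \<in> homog (Suc m) \<Longrightarrow> \<phi> (var i * p) = moment (p * u i)" and q: "q \<in> homog m"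
  shows "moment ((var j * u i - var i * u j) * q) = 0"
proof -
  have "moment (var j * q * u i) = moment (var i * q * u j)"
    using assms(1)[OF var_mult_homog[OF q], of i j] assms(1)[OF var_mult_homog[OF q], of j i]
    by (simp add: mult.left_commute)
  then show ?thesis
    by (simp add: algebra_simps moment_diff)
qed

lemma cross_codeg:
  assumes "\<And>i. u i \<in> codeg (Suc m) e"
  shows "var j * u i - var i * u j \<in> codeg m e"
proof -
  have "var j * u i - var i * u j \<in> codeg (Suc m) (Suc e)"
    using assms by (intro codeg_diff) (simp_all only: var_mult_codeg_iff)
  then show ?thesis by (simp only: codeg_Suc_Suc)
qed

text \<open>The cross differences have degree e - m and are orthogonal to degree m; e <= 2 m is what
  nondegeneracy requires to make them vanish.\<close>

lemma ann_hsym_step: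
  fixes I :: "('n::{finite,linorder}, 'k::field_char_0) mpoly set"
  assumes card: "CARD('n) \<ge> 2" and I: "is_ideal I" and e: "e \<le> 2 * m"
    and low: "homog (Suc m) \<inter> ann (hsym e) \<subseteq> I"
  shows "homog (Suc (Suc m)) \<inter> ann (hsym e) \<subseteq> I"
proof (rule subsetI, rule ccontr)
  fix g assume g: "g \<in> homog (Suc (Suc m)) \<inter> ann (hsym e)" "g \<notin> I"
  obtain \<phi> u where "linear_form \<phi>" "\<And>f. f \<in> I \<Longrightarrow> \<phi> f = 0" and u: "\<And>i. u i \<in> codeg (Suc m) e"
      "\<And>i p. p \<in> homog (Suc m) \<Longrightarrow> \<phi> (var i * p) = moment (p * u i)"
      "\<And>v. v \<in> codeg (Suc (Suc m)) e \<Longrightarrow> (\<And>i. u i = var i * v) \<Longrightarrow> False"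
    using separating_family[OF I low, of g] g by blast
  have "var j * u i - var i * u j = 0" for i j
    using cross_codeg[of u m e j i, OF u(1)]
  proof (cases rule: codeg_cases)
    case 2
    show ?thesis
    proof (rule homog_nondegenerate[OF 2(2)])
      show "e - m \<le> m" using e by simp
    qed (rule separating_family_cross[OF u(2)])
  qed
  then obtain v where v: "\<And>i. u i = var i * v"
    using var_quotient[OF card, of u] by (metis right_minus_eq)
  \<comment> \<open>Any single index reveals the degree of v; \<open>undefined\<close> is an
    arbitrary one.\<close>
  then have "var undefined * v \<in> codeg (Suc (Suc m)) (Suc e)"
    using u(1)[of undefined] by (simp add: codeg_Suc_Suc)
  then have "v \<in> codeg (Suc (Suc m)) e" by (simp only: var_mult_codeg_iff)
  then show False using u(3) v by blast
qed

section \<open>Degrees up to the middle, and membership of the generators\<close>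

lemma ann_hsym_low:
  fixes g :: "('n::{finite,linorder}, 'k::field_char_0) mpoly"
  assumes "g \<in> homog m" "2 * m \<le> e" "g \<in> ann (hsym e)"
  shows "g = 0"
proof (rule homog_nondegenerate[OF assms(1)])
  show "m \<le> e - m" using assms(2) by simp
next
  fix f :: "('n, 'k) mpoly" assume "f \<in> homog (e - m)"
  then have "f \<in> codeg m e" using assms(2) by (auto simp: homog_iff codeg_iff)
  then show "moment (g * f) = 0" using assms by (simp add: ann_hsym_iff)
qed

text \<open>Test forms have degree e - (j + p) < p, so g is orthogonal to them, and the power of
  \<open>ell\<close> does not matter.\<close>

lemma ell_power_M_ann_hsym:
  assumes "g \<in> M p" "e < 2 * p + j"
  shows "ell ^ j * g \<in> ann (hsym e)"
proof -
  have g: "g \<in> homog p" using assms(1) by (simp add: M_iff)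
  have "moment (ell ^ j * g * u) = 0" if "u \<in> codeg (j + p) e" for u
    using that
  proof (cases rule: codeg_cases)
    case 2
    then have "moment (g * u) = 0" using assms by (intro M_orthogonal[of g p u "e - (j + p)"]) auto
    then show ?thesis
      using moment_ell_power_mult_eq_0_iff[OF homog_mult[OF g 2(2)]] by (simp add: mult.assoc)
  qed simp
  then show ?thesis
    using ann_hsym_iff[OF homog_mult[OF ell_power_homog g, of j]] by blast
qed

lemma ann_hsym_subset_ideal:
  fixes I :: "('n::{finite,linorder}, 'k::field_char_0) mpoly set"
  assumes "is_ideal I" "\<And>m. homog m \<inter> ann (hsym e) \<subseteq> I"
  shows "ann (hsym e) \<subseteq> I"
proof
  fix g :: "('n, 'k) mpoly" assume g: "g \<in> ann (hsym e)"
  have "hcomp m g \<in> I" for m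
    using assms(2) hcomp_homog hcomp_ann_hsym[OF g] by blast
  then have "(\<Sum>m\<in>A. hcomp m g) \<in> I" for A
    by (induction A rule: infinite_finite_induct) (use is_idealD(1,2)[OF assms(1)] in simp_all)
  then show "g \<in> I" by (metis sum_hcomp)
qed

text \<open>Decomposing twice gives g = g0 + ell h0 + ell^2 k. Test forms of degree d - 1 are
  orthogonal to the first two terms, which forces k = 0.\<close>

lemma ann_hsym_even_middle:
  fixes g :: "('n::{finite,linorder}, 'k::field_char_0) mpoly"
  assumes g: "g \<in> homog (Suc d)" "g \<in> ann (hsym (2 * d))"
  shows "g \<in> M (Suc d) + (\<lambda>f. ell * f) ` M d"
proof -
  obtain g0 h where g0: "g0 \<in> M (Suc d)" and h: "h \<in> homog d" and g_eq: "g = g0 + ell * h"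
    using homog_decompose[OF g(1)] by (metis One_nat_def codeg_Suc_Suc codeg_0_left)
  obtain h0 k where h0: "h0 \<in> M d" and k: "k \<in> codeg 1 d" and h_eq: "h = h0 + ell * k"
    using homog_decompose[OF h] by metis
  have "k = 0"
    using k
  proof (cases rule: codeg_cases)
    case 2
    show ?thesis
    proof (rule homog_nondegenerate_eq[OF 2(2)])
      fix f :: "('n, 'k) mpoly" assume f: "f \<in> homog (d - 1)"
      then have "f \<in> codeg (Suc d) (2 * d)" using 2(1) by (auto simp: homog_iff codeg_iff)
      then have "moment (g * f) = 0" using g ann_hsym_iff[OF g(1)] by blast
      moreover have "moment (g0 * f) = 0" "moment (ell * (h0 * f)) = 0"
        using M_orthogonal[OF g0 f] M_orthogonal_ell[OF h0 f] 2(1) by auto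
      moreover have "g * f = g0 * f + ell * (h0 * f) + ell ^ 2 * (k * f)"
        by (simp add: g_eq h_eq power2_eq_square algebra_simps)
      ultimately show "moment (k * f) = 0"
        using moment_ell_power_mult_eq_0_iff[OF homog_mult[OF 2(2) f], of 2] by (simp add: moment_add)
    qed
  qed
  then show ?thesis using g0 h0 g_eq h_eq by (auto intro: set_plus_intro)
qed

lemma ann_hsym_odd_middle:
  fixes g :: "('n::{finite,linorder}, 'k::field_char_0) mpoly"
  assumes g: "g \<in> homog (Suc d)" "g \<in> ann (hsym (2 * d + 1))"
  shows "g \<in> M (Suc d)"
proof (rule orthogonal_imp_M[OF g(1)])
  fix f :: "('n, 'k) mpoly" assume "f \<in> homog d"
  then have "f \<in> codeg (Suc d) (2 * d + 1)" by (auto simp: homog_iff codeg_iff)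
  then show "moment (g * f) = 0" using g ann_hsym_iff[OF g(1)] by blast
qed

text \<open>Nondegeneracy misses by one degree: the cross differences have degree d + 1 but are
  orthogonal only to degree d. The candidate v comes from the sum of the u_i instead.\<close>

lemma ann_hsym_odd_step:
  fixes I :: "('n::{finite,linorder}, 'k::field_char_0) mpoly set"
  assumes I: "is_ideal I" and M: "M (Suc d) \<subseteq> I" and ellM: "(\<lambda>f. ell ^ 2 * f) ` M d \<subseteq> I"
  shows "homog (Suc (Suc d)) \<inter> ann (hsym (2 * d + 1)) \<subseteq> I"
proof (rule subsetI, rule ccontr)
  fix g assume g: "g \<in> homog (Suc (Suc d)) \<inter> ann (hsym (2 * d + 1))" "g \<notin> I"
  have low: "homog (Suc d) \<inter> ann (hsym (2 * d + 1)) \<subseteq> I"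
    using ann_hsym_odd_middle M by blast
  have shift: "codeg (Suc d) (2 * d + 1) = (homog d :: ('n, 'k) mpoly set)"
    by (auto simp: homog_iff codeg_iff)
  obtain \<phi> u where \<phi>: "linear_form \<phi>" "\<And>f. f \<in> I \<Longrightarrow> \<phi> f = 0"
    and u_codeg: "\<And>i. u i \<in> codeg (Suc d) (2 * d + 1)"
    and u: "\<And>i p. p \<in> homog (Suc d) \<Longrightarrow> \<phi> (var i * p) = moment (p * u i)"
    and no_quotient: "\<And>v. v \<in> codeg (Suc (Suc d)) (2 * d + 1) \<Longrightarrow> (\<And>i. u i = var i * v) \<Longrightarrow> False"
    using separating_family[OF I low, of g] g by blast
  have u_homog: "u i \<in> homog d" for i using u_codeg shift by blast
  have cross: "var j * u i - var i * u j \<in> M (Suc d)" for i j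
  proof (rule orthogonal_imp_M)
    show "var j * u i - var i * u j \<in> homog (Suc d)"
      by (intro homog_diff var_mult_homog u_homog)
  qed (rule separating_family_cross[OF u])
  define s where "s = (\<Sum>i\<in>UNIV. u i)"
  have "s \<in> homog d" unfolding s_def by (intro homog_sum u_homog)
  then obtain s0 v where s0: "s0 \<in> M d" and v: "v \<in> codeg 1 d" and s_eq: "s = s0 + ell * v"
    using homog_decompose by metis
  have ell_v: "moment (f * (ell * v)) = 0" if f: "f \<in> M d" for f
    using v
  proof (cases rule: codeg_cases)
    case 2
    then show ?thesis
      using M_orthogonal_ell[OF f 2(2)] by (simp add: mult.left_commute[of f])
  qed simp
  have "moment (s0 * f) = 0" if f: "f \<in> M d" for f
  proof -
    have fh: "f \<in> homog d" using f by (simp add: M_iff)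
    have "0 = \<phi> (ell ^ 2 * f)"
      using ellM \<phi>(2) f by (metis image_subset_iff)
    also have "ell ^ 2 * f = (\<Sum>i\<in>UNIV. var i * (ell * f))"
      by (simp add: power2_eq_square mult.assoc ell_def sum_distrib_right[symmetric])
    also have "\<phi> \<dots> = (\<Sum>i\<in>UNIV. moment (ell * f * u i))"
      by (simp add: linear_form_sum[OF \<phi>(1)] u[OF ell_mult_homog[OF fh]])
    also have "\<dots> = moment (ell * (f * s))"
      by (simp add: s_def sum_distrib_left moment_sum mult.assoc)
    finally have "moment (f * s) = 0"
      using moment_ell_mult_eq_0_iff[OF homog_mult[OF fh \<open>s \<in> homog d\<close>]] by simp
    then show ?thesis
      using ell_v[OF f] by (simp add: s_eq distrib_left moment_add mult.commute)
  qed
  then have "moment (s0 * f) = 0" if "f \<in> homog d" for f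
  proof -
    obtain f0 h where f: "f0 \<in> M d" "h \<in> codeg 1 d" "f = f0 + ell * h"
      using homog_decompose[OF \<open>f \<in> homog d\<close>] by metis
    have "moment (s0 * (ell * h)) = 0"
      using f(2)
    proof (cases rule: codeg_cases)
      case 2
      then show ?thesis
        using M_orthogonal_ell[OF s0 2(2)] by (simp add: mult.left_commute[of s0])
    qed simp
    with f show ?thesis
      using \<open>\<And>f. f \<in> M d \<Longrightarrow> moment (s0 * f) = 0\<close> by (simp add: distrib_left moment_add)
  qed
  with s0 have "s0 = 0" by (blast intro: M_nondegenerate)
  have var_v: "var i * v \<in> homog d" for i
    using v by (metis codeg_0_left codeg_Suc_Suc One_nat_def var_mult_codeg_iff)
  have "u i = var i * v" for i
  proof -
    \<comment> \<open>Summing the cross differences over j gives ell u_i - x_i s, and s = ell v.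
      Once \<open>ell\<close> is dropped, u_i - x_i v is orthogonal to its own degree.\<close>
    have "ell * (u i - var i * v) = (\<Sum>j\<in>UNIV. var j * u i - var i * u j)"
      using s_eq \<open>s0 = 0\<close>
      by (simp add: sum_subtractf sum_distrib_right[symmetric] sum_distrib_left[symmetric]
          ell_def[symmetric] s_def[symmetric] right_diff_distrib mult.left_commute)
    also have "\<dots> \<in> M (Suc d)"
      by (rule M_sum) (rule cross)
    finally have M: "ell * (u i - var i * v) \<in> M (Suc d)" .
    have "moment ((u i - var i * v) * f) = 0" if f: "f \<in> homog d" for f
      using M_orthogonal[OF M f] moment_ell_mult_eq_0_iff[OF homog_mult[OF homog_diff[OF u_homog var_v] f]]
      by (simp add: mult.assoc)
    then have "u i - var i * v = 0"
      using homog_nondegenerate_eq[OF homog_diff[OF u_homog var_v]] by blast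
    then show ?thesis by simp
  qed
  moreover have "v \<in> codeg (Suc (Suc d)) (2 * d + 1)"
    using v by (auto simp: codeg_iff)
  ultimately show False using no_quotient by blast
qed

theorem theorem2p12:
  fixes d :: nat
  assumes "CARD('n::{finite,linorder}) \<ge> 2"
  shows "((M (d + 1) :: ('n, 'k::field_char_0) mpoly set) \<inter> (\<lambda>f. ell * f) ` M d = {0}
          \<and> ann (hsym (2 * d) :: ('n, 'k) mpoly) =
              ideal_of (M (d + 1) + (\<lambda>f. ell * f) ` M d))
         \<and> ann (hsym (2 * d + 1) :: ('n, 'k) mpoly) =
              ideal_of (M (d + 1) \<union> (\<lambda>f. ell ^ 2 * f) ` M d)"
proof (intro conjI)
  let ?A = "M (d + 1) + (\<lambda>f. ell * f) ` M d :: ('n, 'k) mpoly set"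
  let ?B = "M (d + 1) \<union> (\<lambda>f. ell ^ 2 * f) ` M d :: ('n, 'k) mpoly set"
  show "(M (d + 1) :: ('n, 'k) mpoly set) \<inter> (\<lambda>f. ell * f) ` M d = {0}"
  proof
    show "(M (d + 1) :: ('n, 'k) mpoly set) \<inter> (\<lambda>f. ell * f) ` M d \<subseteq> {0}"
    proof
      fix g :: "('n, 'k) mpoly" assume "g \<in> M (d + 1) \<inter> (\<lambda>f. ell * f) ` M d"
      then obtain f where g: "g = ell * f" and "g \<in> M (d + 1)" "f \<in> M d" by blast
      then have f: "f \<in> homog d" "lowering f = 0" "lowering (ell * f) = 0" by (simp_all add: M_iff)
      \<comment> \<open>If \<open>lowering\<close> kills both f and ell f, the commutator leaves
        only (2 d + n) f = 0.\<close>
      then have "const (of_nat (2 * d + CARD('n))) * f = 0"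
        using lowering_ell_mult[OF f(1)] by simp
      then show "g \<in> {0}" using g
        by (metis const_mult_eq_0_iff of_nat_eq_0_iff add_is_0 zero_less_card_finite less_irrefl insertI1 mult_zero_right)
    qed
    have "(0 :: ('n, 'k) mpoly) \<in> (\<lambda>f. ell * f) ` M d"
      using zero_in_M by (intro image_eqI[of _ _ 0]) auto
    then show "{0} \<subseteq> (M (d + 1) :: ('n, 'k) mpoly set) \<inter> (\<lambda>f. ell * f) ` M d"
      using zero_in_M by auto
  qed
  have "homog m \<inter> ann (hsym (2 * d)) \<subseteq> ideal_of ?A" for m
  proof (induction m)
    case 0
    then show ?case using ann_hsym_low[of _ 0 "2 * d"] is_idealD(1)[OF is_ideal_ideal_of] by fastforce
  next
    case (Suc m)
    \<comment> \<open>The annihilator is 0 up to degree d, degree d + 1 is the middle case, and from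
      d + 2 on \<open>ann_hsym_step\<close> applies because 2 d <= 2 p.\<close>
    consider "Suc m \<le> d" | "m = d" | p where "m = Suc p" "d \<le> p"
      using that(3)[of "m - 1"] by fastforce
    then show ?case
    proof cases
      case 1
      then show ?thesis
        using ann_hsym_low[of _ "Suc m" "2 * d"] is_idealD(1)[OF is_ideal_ideal_of] by fastforce
    next
      case 2
      then show ?thesis by (auto intro!: ideal_of_base ann_hsym_even_middle)
    next
      case 3
      then show ?thesis using Suc ann_hsym_step[OF assms is_ideal_ideal_of, of "2 * d" p ?A] by simp
    qed
  qed
  moreover have "?A \<subseteq> ann (hsym (2 * d))"
  proof
    fix g assume "g \<in> ?A"
    then obtain p q where "g = p + ell * q" "p \<in> M (d + 1)" "q \<in> M d"
      by (auto elim: set_plus_elim)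
    then show "g \<in> ann (hsym (2 * d))"
      using ell_power_M_ann_hsym[of p "d + 1" "2 * d" 0] ell_power_M_ann_hsym[of q d "2 * d" 1]
      by (simp add: ann_add)
  qed
  ultimately show "ann (hsym (2 * d)) = ideal_of ?A"
    by (intro subset_antisym ann_hsym_subset_ideal ideal_of_minimal is_ideal_ideal_of is_ideal_ann)
  have "homog m \<inter> ann (hsym (2 * d + 1)) \<subseteq> ideal_of ?B" for m
  proof (induction m)
    case 0
    then show ?case using ann_hsym_low[of _ 0 "2 * d + 1"] is_idealD(1)[OF is_ideal_ideal_of] by fastforce
  next
    case (Suc m)
    \<comment> \<open>Now 2 d + 1 <= 2 p needs p >= d + 1, so degree d + 2 is handled by
      \<open>ann_hsym_odd_step\<close>.\<close>
    consider "Suc m \<le> d" | "m = d" | "m = Suc d" | p where "m = Suc p" "Suc d \<le> p"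
      using that(4)[of "m - 1"] by fastforce
    then show ?case
    proof cases
      case 1
      then show ?thesis
        using ann_hsym_low[of _ "Suc m" "2 * d + 1"] is_idealD(1)[OF is_ideal_ideal_of] by fastforce
    next
      case 2
      then show ?thesis by (auto intro!: ideal_of_base ann_hsym_odd_middle)
    next
      case 3
      then show ?thesis
        using ann_hsym_odd_step[OF is_ideal_ideal_of, of d ?B] by (simp add: ideal_of_base subset_iff)
    next
      case 4
      then show ?thesis using Suc ann_hsym_step[OF assms is_ideal_ideal_of, of "2 * d + 1" p ?B] by simp
    qed
  qed
  moreover have "?B \<subseteq> ann (hsym (2 * d + 1))"
  proof
    fix g assume "g \<in> ?B"
    then consider "g \<in> M (d + 1)" | f where "g = ell ^ 2 * f" "f \<in> M d" by blast
    then show "g \<in> ann (hsym (2 * d + 1))"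
    proof cases
      case 1
      then show ?thesis using ell_power_M_ann_hsym[of g "d + 1" "2 * d + 1" 0] by simp
    next
      case 2
      then show ?thesis using ell_power_M_ann_hsym[of f d "2 * d + 1" 2] by simp
    qed
  qed
  ultimately show "ann (hsym (2 * d + 1)) = ideal_of ?B"
    by (intro subset_antisym ann_hsym_subset_ideal ideal_of_minimal is_ideal_ideal_of is_ideal_ann)
qed

end
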